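(* Let $q \in (1, q_{\aleph_0}) \setminus \{G\}$ or $q \in \mathcal{T} \cap (q_{\aleph_0}, q_{\mathrm{KL}})$. Then there is some $s > 0$ depending only on $q$ such that for every $y\in[0,1]$ for which $\mathrm{sl}_q(y)$ is uncountable, $\dim_{\mathrm{H}}(\mathrm{sl}_q(y)) \geq s$.
   Context: $G=\frac{1+\sqrt5}{2}$ is the golden ratio. $\mathcal{T}$ is the set of transcendental real numbers. $q_{\aleph_0}\approx 1.64541$ is the root of $x^6 = x^4 + x^3 + 2x^2 + x + 1$ in $(1,2)$. For $q\in(1,2)$ and $x\in[0,\frac1{q-1}]$, a base $q$ expansion of $x$ is a sequence $(i_j)_{j=1}^\infty\in\{0,1\}^{\mathbb{N}}$ with $x=\sum_{j=1}^\infty i_jq^{-j}$. $q_{\mathrm{KL}}\approx 1.78723$ is the Komornik–Loreti constant, the smallest $q\in(1,2)$ for which $1$ has a unique base $q$ expansion. For $q\in(1,2)$ define maps on $[0,1]^2$ (the Okamoto IFS) by $S_0(x,y) = \left(\frac{x}{3}, \frac{y}{q}\right)$, $S_1(x,y) = \left(\frac{x+1}{3}, \left(\frac{2}{q}-1\right)(1-y) + \left(1-\frac{1}{q}\right)\right)$, $S_2(x,y) = \left(\frac{x+2}{3}, \frac{y}{q} + \left(1-\frac{1}{q}\right)\right)$. $K_q$ is the unique nonempty compact subset of $[0,1]^2$ with $K_q = S_0(K_q)\cup S_1(K_q)\cup S_2(K_q)$. For $y\in[0,1]$ the horizontal slice at $y$ is $\mathrm{sl}_q(y) = \{x\in[0,1]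 : (x,y)\in K_q\}$. $\dim_{\mathrm{H}}$ denotes Hausdorff dimension. *)

theory Defs
  imports "HOL-Analysis.Analysis" "HOL-Computational_Algebra.Polynomial"
begin

definition golden_ratio :: real where
  "golden_ratio = (1 + sqrt 5) / 2"

definition transcendental_reals :: "real set" where
  "transcendental_reals = {x. \<not> algebraic x}"

definition q_aleph0 :: real where
  "q_aleph0 = (THE x. 1 < x \<and> x < 2 \<and> x ^ 6 = x ^ 4 + x ^ 3 + 2 * x ^ 2 + x + 1)"

(* Digits are indexed from 0, so digit j has weight q^-(j+1). *)
definition base_expansion :: "real \<Rightarrow> real \<Rightarrow> (nat \<Rightarrow> nat) \<Rightarrow> bool" where
  "base_expansion q x i \<longleftrightarrow>
     (\<forall>j. i j \<in> {0, 1}) \<and> (\<lambda>j. real (i j) / q ^ Suc j) sums x"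

definition q_KL :: real where
  "q_KL = (LEAST q. 1 < q \<and> q < 2 \<and> (\<exists>!i. base_expansion q 1 i))"

definition okamoto_S0 :: "real \<Rightarrow> real \<times> real \<Rightarrow> real \<times> real" where
  "okamoto_S0 q = (\<lambda>(x, y). (x / 3, y / q))"

definition okamoto_S1 :: "real \<Rightarrow> real \<times> real \<Rightarrow> real \<times> real" where
  "okamoto_S1 q = (\<lambda>(x, y). ((x + 1) / 3, (2 / q - 1) * (1 - y) + (1 - 1 / q)))"

definition okamoto_S2 :: "real \<Rightarrow> real \<times> real \<Rightarrow> real \<times> real" where
  "okamoto_S2 q = (\<lambda>(x, y). ((x + 2) / 3, y / q + (1 - 1 / q)))"

definition okamoto_K :: "real \<Rightarrow> (real \<times> real) set" where
  "okamoto_K q = (THE K. K \<noteq> {} \<and> compact K \<and> K \<subseteq> {0..1} \<times> {0..1} \<and>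
     K = okamoto_S0 q ` K \<union> okamoto_S1 q ` K \<union> okamoto_S2 q ` K)"

definition slice :: "real \<Rightarrow> real \<Rightarrow> real set" where
  "slice q y = {x \<in> {0..1}. (x, y) \<in> okamoto_K q}"

(* |U|^s with the usual conventions |{}|^s = 0 and |U|^0 = 1 for nonempty U;
   they are explicit because 0 powr 0 = 0 in the library. *)
definition diameter_powr :: "real \<Rightarrow> 'a::metric_space set \<Rightarrow> real" where
  "diameter_powr s U = (if U = {} then 0 else if s = 0 then 1 else diameter U powr s)"

(* Boundedness is required because diameter carries no information on unbounded sets. *)
definition hausdorff_premeasure :: "real \<Rightarrow> real \<Rightarrow> 'a::metric_space set \<Rightarrow> ennreal" where
  "hausdorff_premeasure s \<delta> A =
     (INF U \<in> {U :: nat \<Rightarrow> 'a set. A \<subseteq> (\<Union>n. U n) \<and>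
                 (\<forall>n. bounded (U n) \<and> diameter (U n) \<le> \<delta>)}.
        \<Sum>n. ennreal (diameter_powr s (U n)))"

definition hausdorff_measure :: "real \<Rightarrow> 'a::metric_space set \<Rightarrow> ennreal" where
  "hausdorff_measure s A = (SUP \<delta> \<in> {0<..}. hausdorff_premeasure s \<delta> A)"

definition hausdorff_dim :: "'a::metric_space set \<Rightarrow> ereal" where
  "hausdorff_dim A = Inf {ereal s | s. 0 \<le> s \<and> hausdorff_measure s A = 0}"

end

theory Submission imports Defs begin

text \<open>
  The first coordinate of a point \<open>(x, y)\<close> of \<open>K\<^sub>q\<close> records a sequence of choices. Let
  \<open>T\<^sub>0 y = q y\<close>, \<open>T\<^sub>1 y = (1 - q y) / (2 - q)\<close> and \<open>T\<^sub>2 y = q y - (q - 1)\<close> be the inverse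
  branches of the second coordinates of the three maps. Then \<open>(x, y) \<in> K\<^sub>q\<close> iff \<open>x\<close> has a ternary
  expansion whose digits tell which branches can be applied to \<open>y\<close> one after the other without
  ever leaving \<open>[0, 1]\<close> (\<open>okamoto_K_eq_coded_set\<close>). On the interval \<open>J = [1 - 1/q, 1/q]\<close> all three
  branches are available, outside it only one is.

  Suppose that some \<open>N\<close> has the property that from every point of \<open>J\<close> two incomparable words of
  length at most \<open>N\<close> lead back into \<open>J\<close>. A slice that can reach \<open>J\<close> at all then contains a tree
  that splits in two at least once every \<open>N\<close> ternary digits, so its dimension is at least
  \<open>ln 2 / (N ln 3)\<close>, whatever \<open>y\<close> is (\<open>hausdorff_dim_slice_ge_of_branching\<close>). An uncountable slice
  does reach \<open>J\<close>, since a point that never meets \<open>J\<close> has no choice at any step. The number \<open>N\<close>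
  comes from compactness: for a fixed word, the points that it sends into the interior of \<open>J\<close>
  form an open set, so it suffices to find one pair of words for each point of \<open>J\<close>. For this it is
  enough that from at least two of the three images of any interior point, and from
  \<open>2 - q = T\<^sub>2 (1/q)\<close>, the interior of \<open>J\<close> can be reached again
  (\<open>uniform_dim_bound_of_branching\<close>).

  The points that cannot reach the interior of \<open>J\<close> are rare, and two images of one point satisfy
  an algebraic relation, namely \<open>T\<^sub>0 y - T\<^sub>2 y = q - 1\<close> or \<open>(2 - q) T\<^sub>1 y = 1 - T\<^sub>0 y\<close> or the
  mirror image of the latter under \<open>y \<mapsto> 1 - y\<close>. So one has to exclude these relations between
  two rare points. For \<open>q\<close> below the golden ratio the rare points are \<open>0\<close> and \<open>1\<close>. Between the
  golden ratio and \<open>q_aleph0 < 1.65\<close> they are \<open>0\<close>, \<open>1\<close> and the points \<open>P / q\<^sup>k\<close>, \<open>1 - P / q\<^sup>k\<close>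
  with \<open>P = q / (q + 1)\<close>, which end in the cycle \<open>01\<close>, and estimates exclude the relations; at the
  golden ratio itself \<open>q\<^sup>2 (2 - q) = 1\<close> produces a coincidence. For transcendental \<open>q < q_KL\<close> the
  rare points have eventually periodic expansions in base \<open>q\<close>, and each relation becomes
  \<open>\<Sum> b\<^sub>i q\<^sup>-\<^sup>i = 0\<close> with an eventually periodic integer sequence \<open>b\<close>. This is a polynomial equation
  for \<open>q\<close>, so \<open>b\<close> vanishes identically (\<open>transcendental_zero_series\<close>), which is absurd.

  Eventual periodicity below \<open>q_KL\<close> is a renormalisation argument. Let \<open>tau = 11010011...\<close> be the
  Thue-Morse sequence without its first digit. Lexicographic comparison with \<open>tau\<close> forces the
  expansion of a point that cannot reach the interior of \<open>J\<close> to be constant, alternating or built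
  from the blocks \<open>10\<close> and \<open>01\<close> from some position on. Since \<open>tau\<close> is \<open>1\<close> followed by its own image under the
  substitution \<open>1 \<mapsto> 10\<close>, \<open>0 \<mapsto> 01\<close>, the sequence of blocks obeys the same constraint with half
  the slack, and the process stops (\<open>admissible_eventually_periodic\<close>). In the base in which
  \<open>tau\<close> represents \<open>1\<close>, no other sequence does, and the same descent shows that no smaller base
  gives \<open>1\<close> a unique expansion; hence that base is \<open>q_KL\<close> (\<open>q_KL_eq_tau_base\<close>).
\<close>

section \<open>Coding of the slices\<close>

text \<open>For \<open>d < 3\<close> this inverts the second coordinate of the map \<open>S\<^sub>d\<close>. It is defined on the
  whole line: leaving the unit interval is what signals that a digit is not available.\<close>

definition inv_branch :: "real \<Rightarrow> nat \<Rightarrow> real \<Rightarrow> real" where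
  "inv_branch q d y =
     (if d = 0 then q * y else if d = 1 then (1 - q * y) / (2 - q) else q * y - (q - 1))"

abbreviation follow :: "real \<Rightarrow> nat list \<Rightarrow> real \<Rightarrow> real" where
  "follow q \<equiv> fold (inv_branch q)"

definition ternary :: "(nat \<Rightarrow> nat) \<Rightarrow> real" where
  "ternary d = (\<Sum>i. real (d i) / 3 ^ Suc i)"

definition slice_code :: "real \<Rightarrow> real \<Rightarrow> (nat \<Rightarrow> nat) \<Rightarrow> bool" where
  "slice_code q y d \<longleftrightarrow>
     (\<forall>i. d i < 3) \<and> (\<forall>n. follow q (map d [0..<n]) y \<in> {0..1})"

text \<open>The complement of the unit interval is mapped into itself by every branch. Hence a word of
  digits is available at a point as soon as its final value lies in the unit interval, and the set
  of points where this happens is the preimage of an interval under one continuous map.\<close>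

lemma inv_branch_in_unit_interval:
  assumes "1 < q" "q < 2" "inv_branch q d y \<in> {0..1}"
  shows "y \<in> {0..1}"
proof -
  have *: "0 \<le> q * y" "q * y \<le> 1 \<or> q * y \<le> q"
    using assms by (auto simp: inv_branch_def zero_le_divide_iff divide_le_eq split: if_splits)
  have "\<not> 1 < y"
  proof
    assume "1 < y"
    then have "q * 1 < q * y" using assms(1) by (intro mult_strict_left_mono) auto
    then show False using * assms(1) by linarith
  qed
  moreover have "0 \<le> y" using * assms(1) by (simp add: zero_le_mult_iff)
  ultimately show ?thesis by simp
qed

lemma follow_in_unit_interval:
  assumes "1 < q" "q < 2" "follow q w y \<in> {0..1}"
  shows "y \<in> {0..1}"
  using assms(3)
proof (induction w arbitrary: y)
  case (Cons d w)
  then have "inv_branch q d y \<in> {0..1}" by (simp only: fold_simps)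
  then show ?case by (rule inv_branch_in_unit_interval[OF assms(1,2)])
qed simp

lemma ternary_summable:
  assumes "\<And>i. d i < 3"
  shows "summable (\<lambda>i. real (d i) / 3 ^ Suc i)"
proof (rule summable_comparison_test)
  show "\<exists>N. \<forall>n\<ge>N. norm (real (d n) / 3 ^ Suc n) \<le> (1 / 3) ^ n"
  proof (intro exI allI impI)
    fix n
    have "d n \<le> 2" using assms[of n] by simp
    then show "norm (real (d n) / 3 ^ Suc n) \<le> (1 / 3) ^ n"
      by (simp add: field_simps power_one_over)
  qed
  show "summable (\<lambda>n. (1 / 3 :: real) ^ n)" by (rule summable_geometric) simp
qed

lemma ternary_Suc:
  assumes "\<And>i. d i < 3"
  shows "ternary d = (real (d 0) + ternary (\<lambda>i. d (Suc i))) / 3"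
proof -
  have s: "summable (\<lambda>i. real (d (Suc i)) / 3 ^ Suc i)"
    using ternary_summable[of "\<lambda>i. d (Suc i)"] assms by simp
  have "ternary d = (\<Sum>i. real (d (Suc i)) / 3 ^ Suc (Suc i)) + real (d 0) / 3 ^ Suc 0"
    unfolding ternary_def using suminf_split_head[OF ternary_summable[of d]] assms by simp
  also have "(\<Sum>i. real (d (Suc i)) / 3 ^ Suc (Suc i)) = (\<Sum>i. (1/3) * (real (d (Suc i)) / 3 ^ Suc i))"
    by simp
  also have "\<dots> = (1/3) * ternary (\<lambda>i. d (Suc i))"
    unfolding ternary_def by (rule suminf_mult[OF s])
  finally show ?thesis by simp
qed

lemma ternary_in_unit_interval:
  assumes "\<And>i. d i < 3"
  shows "ternary d \<in> {0..1}"
proof -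
  have "ternary d \<le> (\<Sum>i. (2/3) * (1 / 3 :: real) ^ i)"
    unfolding ternary_def
  proof (rule suminf_le)
    fix n
    have "d n \<le> 2" using assms[of n] by simp
    then show "real (d n) / 3 ^ Suc n \<le> 2 / 3 * (1 / 3) ^ n"
      by (simp add: field_simps power_one_over)
  qed (use assms ternary_summable in \<open>auto intro!: summable_mult summable_geometric\<close>)
  also have "\<dots> = 1" by (subst suminf_mult) (auto simp: suminf_geometric summable_geometric)
  finally show ?thesis
    using suminf_nonneg[OF ternary_summable[of d]] assms by (simp add: ternary_def)
qed

lemma slice_code_iff:
  "slice_code q y d \<longleftrightarrow>
     d 0 < 3 \<and> y \<in> {0..1} \<and> slice_code q (inv_branch q (d 0) y) (\<lambda>i. d (Suc i))"
  (is "?L \<longleftrightarrow> ?R")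
proof -
  have step: "follow q (map d [0..<Suc n]) y =
      follow q (map (\<lambda>i. d (Suc i)) [0..<n]) (inv_branch q (d 0) y)" for n
    by (subst map_upt_Suc) simp
  show ?thesis
  proof
    assume L: ?L
    show ?R unfolding slice_code_def
    proof (intro conjI allI)
      show "d 0 < 3" "\<And>i. d (Suc i) < 3" using L by (auto simp: slice_code_def)
      have "follow q (map d [0..<0]) y \<in> {0..1}" using L unfolding slice_code_def by blast
      then show "y \<in> {0..1}" by simp
      show "follow q (map (\<lambda>i. d (Suc i)) [0..<n]) (inv_branch q (d 0) y) \<in> {0..1}" for n
        using L step[of n] unfolding slice_code_def by metis
    qed
  next
    assume R: ?R
    show ?L unfolding slice_code_def
    proof (intro conjI allI)
      show "d i < 3" for i using R by (cases i) (auto simp: slice_code_def)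
      show "follow q (map d [0..<n]) y \<in> {0..1}" for n
      proof (cases n)
        case 0 then show ?thesis using R by simp
      next
        case (Suc m) then show ?thesis using R step[of m] unfolding slice_code_def by metis
      qed
    qed
  qed
qed

definition okamoto_step :: "real \<Rightarrow> (real \<times> real) set \<Rightarrow> (real \<times> real) set" where
  "okamoto_step q A = okamoto_S0 q ` A \<union> okamoto_S1 q ` A \<union> okamoto_S2 q ` A"

lemma less_3_cases: "(d::nat) < 3 \<longleftrightarrow> d = 0 \<or> d = 1 \<or> d = 2"
  by auto

text \<open>The three maps are affine bijections of the plane, so membership in an image can be read as
  membership of the preimage under one of the inverses.\<close>

lemma mem_okamoto_step_iff:
  assumes "1 < q" "q < 2"
  shows "(x, y) \<in> okamoto_step q A \<longleftrightarrow>
    (\<exists>d<3. (3 * x - real d, inv_branch q d y) \<in> A)"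
proof -
  have 0: "(x, y) \<in> okamoto_S0 q ` A \<longleftrightarrow> (3 * x - real 0, inv_branch q 0 y) \<in> A"
  proof
    assume "(3 * x - real 0, inv_branch q 0 y) \<in> A"
    then show "(x, y) \<in> okamoto_S0 q ` A"
      by (rule image_eqI[rotated]) (use assms in \<open>simp add: okamoto_S0_def inv_branch_def\<close>)
  qed (use assms in \<open>auto simp: okamoto_S0_def inv_branch_def\<close>)
  have eq1: "(1 - q * ((2 / q - 1) * (1 - b) + (1 - 1 / q))) / (2 - q) = b" for b
    using assms by (simp add: field_simps)
  have eq1': "y = (2 / q - 1) * (1 - (1 - q * y) / (2 - q)) + (1 - 1 / q)"
    using assms by (simp add: field_simps)
  have 1: "(x, y) \<in> okamoto_S1 q ` A \<longleftrightarrow> (3 * x - real 1, inv_branch q 1 y) \<in> A"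
  proof
    assume "(3 * x - real 1, inv_branch q 1 y) \<in> A"
    then show "(x, y) \<in> okamoto_S1 q ` A"
      by (rule image_eqI[rotated])
        (use eq1' in \<open>simp add: okamoto_S1_def inv_branch_def\<close>)
  next
    assume "(x, y) \<in> okamoto_S1 q ` A"
    then show "(3 * x - real 1, inv_branch q 1 y) \<in> A"
      using eq1 by (auto simp: okamoto_S1_def inv_branch_def simp del: distrib_left_numeral)
  qed
  have eq2: "q * (b / q + (1 - 1 / q)) - (q - 1) = b" for b
    using assms by (simp add: field_simps)
  have eq2': "y = (q * y - (q - 1)) / q + (1 - 1 / q)"
    using assms by (simp add: field_simps)
  have 2: "(x, y) \<in> okamoto_S2 q ` A \<longleftrightarrow> (3 * x - real 2, inv_branch q 2 y) \<in> A"
  proof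
    assume "(3 * x - real 2, inv_branch q 2 y) \<in> A"
    then show "(x, y) \<in> okamoto_S2 q ` A"
      by (rule image_eqI[rotated])
        (use eq2' in \<open>simp add: okamoto_S2_def inv_branch_def\<close>)
  next
    assume "(x, y) \<in> okamoto_S2 q ` A"
    then show "(3 * x - real 2, inv_branch q 2 y) \<in> A"
      using eq2 by (auto simp: okamoto_S2_def inv_branch_def simp del: distrib_left_numeral)
  qed
  show ?thesis
    unfolding okamoto_step_def Un_iff 0 1 2 less_3_cases by blast
qed

definition coded_set :: "real \<Rightarrow> (real \<times> real) set" where
  "coded_set q = {(ternary d, y) | d y. slice_code q y d}"

lemma coded_set_invariant:
  assumes "1 < q" "q < 2"
  shows "okamoto_step q (coded_set q) = coded_set q"
proof (rule set_eqI, clarify)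
  fix x y
  show "(x, y) \<in> okamoto_step q (coded_set q) \<longleftrightarrow> (x, y) \<in> coded_set q"
  proof
    assume "(x, y) \<in> okamoto_step q (coded_set q)"
    then obtain k d where k: "k < 3" "3 * x - real k = ternary d"
      and d: "slice_code q (inv_branch q k y) d"
      unfolding mem_okamoto_step_iff[OF assms] coded_set_def by auto
    define e where "e = case_nat k d"
    have "inv_branch q k y \<in> {0..1}" using d slice_code_iff by blast
    then have "y \<in> {0..1}" using inv_branch_in_unit_interval[OF assms] by blast
    then have e: "slice_code q y e"
      using k d by (subst slice_code_iff) (simp add: e_def)
    then have "ternary e = (real k + ternary d) / 3"
      using ternary_Suc[of e] by (simp add: slice_code_def e_def)
    then have "x = ternary e" using k by simp
    then show "(x, y) \<in> coded_set q" using e unfolding coded_set_def by blast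
  next
    assume "(x, y) \<in> coded_set q"
    then obtain d where d: "x = ternary d" "slice_code q y d" unfolding coded_set_def by blast
    then have "3 * x - real (d 0) = ternary (\<lambda>i. d (Suc i))"
      using ternary_Suc[of d] by (simp add: slice_code_def)
    then have "(3 * x - real (d 0), inv_branch q (d 0) y) \<in> coded_set q"
      using d slice_code_iff[of q y d] unfolding coded_set_def by blast
    then show "(x, y) \<in> okamoto_step q (coded_set q)"
      unfolding mem_okamoto_step_iff[OF assms] using d slice_code_iff[of q y d] by blast
  qed
qed

lemma coded_set_in_unit_square: "coded_set q \<subseteq> {0..1} \<times> {0..1}"
proof clarify
  fix x y assume "(x, y) \<in> coded_set q"
  then obtain d where "x = ternary d" "slice_code q y d" unfolding coded_set_def by blast
  then show "x \<in> {0..1} \<and> y \<in> {0..1}"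
    using ternary_in_unit_interval[of d] slice_code_iff[of q y d] unfolding slice_code_def by blast
qed

text \<open>The attractor will be obtained as the closure of the coded set. Taking closures keeps the
  invariance because the maps send compact sets to compact sets.\<close>

lemma okamoto_step_closure:
  assumes "bounded A"
  shows "okamoto_step q (closure A) = closure (okamoto_step q A)"
proof -
  have eq: "closure (S ` A) = S ` closure A"
    if c: "continuous_on UNIV S" for S :: "real \<times> real \<Rightarrow> real \<times> real"
  proof
    have cc: "continuous_on (closure A) S" using c continuous_on_subset by blast
    have "closed (S ` closure A)"
      using compact_continuous_image[OF cc] assms compact_imp_closed by (simp add: compact_closure)
    then show "closure (S ` A) \<subseteq> S ` closure A"
      by (intro closure_minimal image_mono closure_subset)
    show "S ` closure A \<subseteq> closure (S ` A)"
      by (rule image_closure_subset[OF cc]) (auto simp: closure_subset)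
  qed
  have "continuous_on UNIV (okamoto_S0 q)" "continuous_on UNIV (okamoto_S1 q)"
    "continuous_on UNIV (okamoto_S2 q)"
    unfolding okamoto_S0_def okamoto_S1_def okamoto_S2_def case_prod_beta divide_inverse
    by (intro continuous_intros)+
  then show ?thesis unfolding okamoto_step_def by (simp add: closure_Un eq)
qed

text \<open>Inside an invariant set one can choose preimages forever; the chosen maps are the digits of
  a code, and the first coordinate is recovered from them because it is bounded along the orbit.\<close>

lemma invariant_subset_coded_set:
  assumes q: "1 < q" "q < 2" and K: "K \<subseteq> {0..1} \<times> {0..1}" "K \<subseteq> okamoto_step q K"
  shows "K \<subseteq> coded_set q"
proof clarify
  fix x y assume xy: "(x, y) \<in> K"
  have "\<forall>p\<in>K. \<exists>d<3. (3 * fst p - real d, inv_branch q d (snd p)) \<in> K"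
  proof
    fix p assume "p \<in> K"
    then have "(fst p, snd p) \<in> okamoto_step q K" using K(2) by auto
    then show "\<exists>d<3. (3 * fst p - real d, inv_branch q d (snd p)) \<in> K"
      unfolding mem_okamoto_step_iff[OF q] .
  qed
  then obtain f where f: "\<And>p. p \<in> K \<Longrightarrow> f p < 3"
      "\<And>p. p \<in> K \<Longrightarrow> (3 * fst p - real (f p), inv_branch q (f p) (snd p)) \<in> K"
    by metis
  define g where "g p = (3 * fst p - real (f p), inv_branch q (f p) (snd p))" for p
  define p where "p n = (g ^^ n) (x, y)" for n
  define d where "d n = f (p n)" for n
  have pK: "p n \<in> K" for n
  proof (induction n)
    case (Suc n) then show ?case using f(2)[of "p n"] by (simp add: p_def g_def)
  qed (simp add: p_def xy)
  have d3: "d n < 3" for n using f(1) pK by (simp add: d_def)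
  have "follow q (map d [0..<n]) y = snd (p n)" for n
    by (induction n) (simp_all add: p_def g_def d_def)
  moreover have "snd (p n) \<in> {0..1}" for n using pK[of n] K(1) by (cases "p n") auto
  ultimately have code: "slice_code q y d" unfolding slice_code_def using d3 by simp
  have sum: "(\<Sum>i<n. real (d i) / 3 ^ Suc i) = x - fst (p n) / 3 ^ n" for n
  proof (induction n)
    case (Suc n)
    have "fst (p (Suc n)) = 3 * fst (p n) - real (d n)" by (simp add: p_def g_def d_def)
    then show ?case using Suc by (simp add: field_simps)
  qed (simp add: p_def)
  have "(\<lambda>n. fst (p n) / 3 ^ n) \<longlonglongrightarrow> 0"
  proof (rule tendsto_sandwich)
    have "fst (p n) \<in> {0..1}" for n using pK[of n] K(1) by (cases "p n") auto
    then show "eventually (\<lambda>n. 0 \<le> fst (p n) / 3 ^ n) sequentially"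
      "eventually (\<lambda>n. fst (p n) / 3 ^ n \<le> (1 / 3) ^ n) sequentially"
      by (auto simp: power_one_over divide_simps)
    show "(\<lambda>n. (1 / 3 :: real) ^ n) \<longlonglongrightarrow> 0" by (rule LIMSEQ_realpow_zero) auto
  qed simp
  then have "(\<lambda>n. x - fst (p n) / 3 ^ n) \<longlonglongrightarrow> x - 0" by (intro tendsto_intros)
  then have "(\<lambda>i. real (d i) / 3 ^ Suc i) sums x" unfolding sums_def sum by simp
  then have "x = ternary d" unfolding ternary_def by (rule sums_unique)
  then show "(x, y) \<in> coded_set q" using code unfolding coded_set_def by blast
qed

lemma inv_branch_expands:
  assumes "1 < q" "q < 2"
  shows "q * \<bar>y - z\<bar> \<le> \<bar>inv_branch q d y - inv_branch q d z\<bar>"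
proof -
  have *: "q * \<bar>y - z\<bar> = \<bar>q * y - q * z\<bar>"
    using assms by (simp add: abs_mult flip: right_diff_distrib)
  show ?thesis
  proof (cases "d = 1")
    case True
    have "\<bar>inv_branch q d y - inv_branch q d z\<bar> = \<bar>q * y - q * z\<bar> / (2 - q)"
      using assms True by (simp add: inv_branch_def abs_divide flip: diff_divide_distrib)
    moreover have "\<bar>q * y - q * z\<bar> \<le> \<bar>q * y - q * z\<bar> / (2 - q)"
      using assms mult_right_mono[of 1 q "\<bar>q * y - q * z\<bar>"] by (simp add: field_simps)
    ultimately show ?thesis using * by simp
  next
    case False
    then show ?thesis using * by (simp add: inv_branch_def)
  qed
qed

text \<open>Applying the first \<open>n\<close> maps of a code to an arbitrary point of the set gives a point of the
  set at distance at most \<open>(1/3)\<^sup>n\<close> and \<open>(1/q)\<^sup>n\<close> from the coded point in the two coordinates.\<close>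

lemma coded_set_subset_invariant:
  assumes q: "1 < q" "q < 2" and K: "K \<noteq> {}" "closed K" "K \<subseteq> {0..1} \<times> {0..1}"
    "okamoto_step q K \<subseteq> K"
  shows "coded_set q \<subseteq> K"
proof clarify
  have approx: "\<exists>p\<in>K. \<bar>fst p - ternary d\<bar> \<le> (1/3)^n \<and> \<bar>snd p - y\<bar> \<le> (1/q)^n"
    if "slice_code q y d" for n y d
    using that
  proof (induction n arbitrary: y d)
    case 0
    obtain a b where ab: "(a, b) \<in> K" using K(1) by auto
    then have "a \<in> {0..1}" "b \<in> {0..1}" using K(3) by auto
    moreover have "ternary d \<in> {0..1}" "y \<in> {0..1}"
      using 0 ternary_in_unit_interval[of d] slice_code_iff[of q y d]
      unfolding slice_code_def by blast+
    ultimately show ?case using ab by (intro bexI[of _ "(a, b)"]) auto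
  next
    case (Suc n)
    have d: "d 0 < 3" "slice_code q (inv_branch q (d 0) y) (\<lambda>i. d (Suc i))"
      using Suc.prems slice_code_iff by blast+
    from Suc.IH[OF d(2)] obtain a b where ab: "(a, b) \<in> K"
      "\<bar>a - ternary (\<lambda>i. d (Suc i))\<bar> \<le> (1/3)^n" "\<bar>b - inv_branch q (d 0) y\<bar> \<le> (1/q)^n"
      by auto
    obtain z where z: "inv_branch q (d 0) z = b"
    proof (cases "d 0 = 0")
      case True then show ?thesis using that[of "b / q"] q by (simp add: inv_branch_def)
    next
      case F: False
      show ?thesis
      proof (cases "d 0 = 1")
        case True then show ?thesis using that[of "(1 - b * (2 - q)) / q"] q
          by (simp add: inv_branch_def)
      next
        case False then show ?thesis using F that[of "(b + (q - 1)) / q"] q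
          by (simp add: inv_branch_def)
      qed
    qed
    have "((real (d 0) + a) / 3, z) \<in> K"
    proof -
      have "3 * ((real (d 0) + a) / 3) - real (d 0) = a"
        by (simp del: distrib_left_numeral)
      then have "((real (d 0) + a) / 3, z) \<in> okamoto_step q K"
        unfolding mem_okamoto_step_iff[OF q] using d(1) ab(1) z by metis
      then show ?thesis using K(4) by blast
    qed
    moreover have "\<bar>(real (d 0) + a) / 3 - ternary d\<bar> \<le> (1/3) ^ Suc n"
    proof -
      have "ternary d = (real (d 0) + ternary (\<lambda>i. d (Suc i))) / 3"
        using Suc.prems by (intro ternary_Suc) (simp add: slice_code_def)
      then have "(real (d 0) + a) / 3 - ternary d = (a - ternary (\<lambda>i. d (Suc i))) / 3"
        by argo
      then show ?thesis using ab(2) by (simp add: abs_divide del: divide_const_simps)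
    qed
    moreover have "q * \<bar>z - y\<bar> \<le> (1/q) ^ n"
      using inv_branch_expands[OF q, of z y "d 0"] z ab(3) by simp
    then have "\<bar>z - y\<bar> \<le> (1/q) ^ Suc n" using q by (simp add: field_simps)
    ultimately show ?case by force
  qed
  fix x y assume "(x, y) \<in> coded_set q"
  then obtain d where d: "x = ternary d" "slice_code q y d" unfolding coded_set_def by blast
  then have "\<forall>n. \<exists>p\<in>K. \<bar>fst p - x\<bar> \<le> (1/3)^n \<and> \<bar>snd p - y\<bar> \<le> (1/q)^n"
    using approx by blast
  then obtain p where p: "\<And>n. p n \<in> K" "\<And>n. \<bar>fst (p n) - x\<bar> \<le> (1/3)^n"
      "\<And>n. \<bar>snd (p n) - y\<bar> \<le> (1/q)^n"
    by metis
  have "(\<lambda>n. fst (p n)) \<longlonglongrightarrow> x"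
  proof (rule LIM_zero_cancel, rule Lim_null_comparison)
    show "(\<lambda>n. (1 / 3 :: real) ^ n) \<longlonglongrightarrow> 0" by (rule LIMSEQ_realpow_zero) auto
  qed (use p in auto)
  moreover have "(\<lambda>n. snd (p n)) \<longlonglongrightarrow> y"
  proof (rule LIM_zero_cancel, rule Lim_null_comparison)
    show "(\<lambda>n. (1 / q) ^ n) \<longlonglongrightarrow> 0" by (rule LIMSEQ_realpow_zero) (use q in auto)
  qed (use p in auto)
  ultimately have "(\<lambda>n. (fst (p n), snd (p n))) \<longlonglongrightarrow> (x, y)" by (rule tendsto_Pair)
  then show "(x, y) \<in> K" using closed_sequentially[OF K(2), of p] p(1) by simp
qed

text \<open>The two inclusions above identify every candidate for the attractor with the coded set. The
  closure of the coded set is such a candidate, so the coded set is closed and is the attractor.\<close>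

lemma okamoto_K_eq_coded_set:
  assumes q: "1 < q" "q < 2"
  shows "okamoto_K q = coded_set q"
proof -
  let ?P = "\<lambda>K. K \<noteq> {} \<and> compact K \<and> K \<subseteq> {0..1} \<times> {0..1} \<and>
     K = okamoto_S0 q ` K \<union> okamoto_S1 q ` K \<union> okamoto_S2 q ` K"
  have uniq: "K = coded_set q" if "?P K" for K
  proof
    from that have "okamoto_step q K = K" by (simp add: okamoto_step_def)
    then show "K \<subseteq> coded_set q" "coded_set q \<subseteq> K"
      using that invariant_subset_coded_set[OF q, of K] coded_set_subset_invariant[OF q, of K]
        compact_imp_closed[of K] by blast+
  qed
  let ?C = "closure (coded_set q)"
  have "follow q (map (\<lambda>_. 0) [0..<n]) 0 = 0" for n
    by (induction n) (simp_all add: inv_branch_def)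
  then have "slice_code q 0 (\<lambda>_. 0)" by (simp add: slice_code_def)
  then have "coded_set q \<noteq> {}" unfolding coded_set_def by blast
  moreover have b: "bounded (coded_set q)"
    using coded_set_in_unit_square by (rule bounded_subset[rotated]) (simp add: bounded_Times)
  moreover have "okamoto_step q ?C = ?C"
    using okamoto_step_closure[OF b] coded_set_invariant[OF q] by simp
  moreover have "?C \<subseteq> {0..1} \<times> {0..1}"
    by (rule closure_minimal[OF coded_set_in_unit_square]) (simp add: closed_Times)
  ultimately have "?P ?C" by (auto simp: compact_closure okamoto_step_def)
  then have "?P (coded_set q)" using uniq[of ?C] by metis
  then show ?thesis unfolding okamoto_K_def by (rule the_equality) (rule uniq)
qed

lemma slice_eq:
  assumes "1 < q" "q < 2"
  shows "slice q y = {ternary d | d. slice_code q y d}"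
proof -
  have "x \<in> {0..1}" if "(x, y) \<in> coded_set q" for x
    using that coded_set_in_unit_square[of q] by blast
  then show ?thesis
    unfolding slice_def okamoto_K_eq_coded_set[OF assms] coded_set_def by blast
qed

section \<open>Expansions in a real base\<close>

definition beta_val :: "real \<Rightarrow> (nat \<Rightarrow> bool) \<Rightarrow> real" where
  "beta_val q c = (\<Sum>i. of_bool (c i) / q ^ Suc i)"

lemma beta_summable:
  assumes "1 < q"
  shows "summable (\<lambda>i. of_bool (c i) / q ^ Suc i :: real)"
proof (rule summable_comparison_test)
  show "\<exists>N. \<forall>n\<ge>N. norm (of_bool (c n) / q ^ Suc n :: real) \<le> (1 / q) ^ Suc n"
    using assms by (auto simp: power_one_over)
  show "summable (\<lambda>n. (1 / q) ^ Suc n)"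
    by (subst summable_Suc_iff) (use assms in \<open>simp add: summable_geometric\<close>)
qed

lemma beta_val_split:
  assumes "1 < q"
  shows "beta_val q c = (\<Sum>i<n. of_bool (c i) / q ^ Suc i) + beta_val q (\<lambda>i. c (n + i)) / q ^ n"
proof -
  have "beta_val q c = (\<Sum>i. of_bool (c (i + n)) / q ^ Suc (i + n)) + (\<Sum>i<n. of_bool (c i) / q ^ Suc i)"
    unfolding beta_val_def by (rule suminf_split_initial_segment[OF beta_summable[OF assms]])
  also have "(\<lambda>i. of_bool (c (i + n)) / q ^ Suc (i + n)) =
      (\<lambda>i. (1 / q ^ n) * (of_bool (c (n + i)) / q ^ Suc i))"
    by (simp add: power_add field_simps)
  also have "(\<Sum>i. (1 / q ^ n) * (of_bool (c (n + i)) / q ^ Suc i)) =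
      (1 / q ^ n) * beta_val q (\<lambda>i. c (n + i))"
    unfolding beta_val_def by (rule suminf_mult[OF beta_summable[OF assms]])
  finally show ?thesis by simp
qed

lemma beta_val_Suc:
  assumes "1 < q"
  shows "beta_val q c = (of_bool (c 0) + beta_val q (\<lambda>i. c (Suc i))) / q"
  using beta_val_split[OF assms, of c 1] by (simp add: add_divide_distrib)

lemma beta_val_nonneg: "1 < q \<Longrightarrow> 0 \<le> beta_val q c"
  unfolding beta_val_def by (rule suminf_nonneg[OF beta_summable]) auto

lemma beta_val_not:
  assumes "1 < q"
  shows "beta_val q (\<lambda>i. \<not> c i) = 1 / (q - 1) - beta_val q c"
proof -
  have "beta_val q (\<lambda>i. \<not> c i) + beta_val q c = (\<Sum>i. of_bool (\<not> c i) / q ^ Suc i + of_bool (c i) / q ^ Suc i)"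
    unfolding beta_val_def by (intro suminf_add beta_summable assms)
  also have "\<dots> = (\<Sum>i. (1 / q) * (1 / q) ^ i)"
    by (intro suminf_cong) (auto simp: power_one_over)
  also have "\<dots> = (1 / q) * (1 / (1 - 1 / q))"
    using assms by (subst suminf_mult) (auto simp: suminf_geometric summable_geometric)
  also have "\<dots> = 1 / (q - 1)" using assms by (simp add: field_simps)
  finally show ?thesis by simp
qed

lemma beta_val_le: "1 < q \<Longrightarrow> beta_val q c \<le> 1 / (q - 1)"
  using beta_val_not[of q c] beta_val_nonneg[of q "\<lambda>i. \<not> c i"] by simp

text \<open>If the orbit under \<open>x \<mapsto> q x - digit\<close> stays bounded, its digits expand the starting point,
  since the error after \<open>n\<close> digits is the \<open>n\<close>-th orbit point divided by \<open>q\<^sup>n\<close>.\<close>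

lemma beta_val_orbitI:
  assumes q: "1 < q" and step: "\<And>n. x (Suc n) = q * x n - of_bool (c n)"
    and bounded: "\<And>n. \<bar>x n\<bar> \<le> B"
  shows "beta_val q c = x 0"
proof -
  have sum: "(\<Sum>i<n. of_bool (c i) / q ^ Suc i) = x 0 - x n / q ^ n" for n
  proof (induction n)
    case (Suc n)
    have "x n / q ^ n = (of_bool (c n) + x (Suc n)) / q ^ Suc n" using q by (simp add: step)
    then show ?case using Suc by (simp add: add_divide_distrib)
  qed simp
  have "(\<lambda>n. x n / q ^ n) \<longlonglongrightarrow> 0"
  proof (rule Lim_null_comparison)
    show "\<forall>\<^sub>F n in sequentially. norm (x n / q ^ n) \<le> B * (1 / q) ^ n"
      using bounded q by (simp add: power_one_over divide_right_mono)
    have "(\<lambda>n. (1 / q) ^ n) \<longlonglongrightarrow> 0" by (rule LIMSEQ_realpow_zero) (use q in auto)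
    then show "(\<lambda>n. B * (1 / q) ^ n) \<longlonglongrightarrow> 0" by (rule tendsto_mult_right_zero)
  qed
  then have "(\<lambda>n. x 0 - x n / q ^ n) \<longlonglongrightarrow> x 0 - 0" by (intro tendsto_intros)
  then have "(\<lambda>i. of_bool (c i) / q ^ Suc i) sums x 0" unfolding sums_def sum by simp
  then show ?thesis unfolding beta_val_def by (rule sums_unique[symmetric])
qed

text \<open>The greedy choice of digits keeps the orbit in the admissible interval. The base \<open>2\<close> is
  included for the binary expansions in the dimension estimate.\<close>

lemma beta_expansion_exists:
  assumes q: "1 < q" "q \<le> 2" and x: "0 \<le> x" "x \<le> 1 / (q - 1)"
  shows "\<exists>c. beta_val q c = x"
proof -
  define g where "g z = q * z - of_bool (1 \<le> q * z)" for z
  define z where "z n = (g ^^ n) x" for n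
  have step: "0 \<le> g w \<and> g w \<le> 1 / (q - 1)" if w: "0 \<le> w" "w \<le> 1 / (q - 1)" for w
  proof -
    have "1 \<le> 1 / (q - 1)" using q by simp
    moreover have "q * w \<le> q * (1 / (q - 1))" using w q by (intro mult_left_mono) auto
    then have "q * w - 1 \<le> 1 / (q - 1)" using q by (simp add: field_simps)
    ultimately show ?thesis unfolding g_def using w q
      by (cases "1 \<le> q * w") (auto intro: order_trans[of _ 1])
  qed
  have z: "0 \<le> z n \<and> z n \<le> 1 / (q - 1)" for n
  proof (induction n)
    case (Suc n) then show ?case using step[of "z n"] by (simp add: z_def)
  qed (use x in \<open>simp add: z_def\<close>)
  have "beta_val q (\<lambda>n. 1 \<le> q * z n) = z 0"
  proof (rule beta_val_orbitI[OF q(1)])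
    show "z (Suc n) = q * z n - of_bool (1 \<le> q * z n)" for n by (simp add: z_def g_def)
    show "\<bar>z n\<bar> \<le> 1 / (q - 1)" for n using z[of n] by simp
  qed
  then show ?thesis by (auto simp: z_def)
qed


section \<open>A lower bound for the Hausdorff dimension of coded trees\<close>

primrec ternary_prefix :: "(nat \<Rightarrow> nat) \<Rightarrow> nat \<Rightarrow> nat" where
  "ternary_prefix d 0 = 0"
| "ternary_prefix d (Suc m) = 3 * ternary_prefix d m + d m"

lemma ternary_prefix_inj:
  assumes "\<And>i. d i < 3" "\<And>i. e i < 3" "ternary_prefix d m = ternary_prefix e m" "i < m"
  shows "d i = e i"
  using assms(3,4)
proof (induction m)
  case (Suc m)
  have "d m < 3" "e m < 3" using assms by auto
  then have "ternary_prefix d m = ternary_prefix e m \<and> d m = e m"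
    using Suc.prems(1) by simp arith
  then show ?case using Suc by (cases "i = m") auto
qed simp

lemma ternary_eq_prefix_add_tail:
  assumes "\<And>i. d i < 3"
  shows "3 ^ m * ternary d = real (ternary_prefix d m) + ternary (\<lambda>i. d (m + i))"
proof (induction m)
  case (Suc m)
  have "ternary (\<lambda>i. d (m + i)) = (real (d m) + ternary (\<lambda>i. d (Suc m + i))) / 3"
    using ternary_Suc[of "\<lambda>i. d (m + i)"] assms by simp
  then show ?case using Suc by simp
qed simp

text \<open>A set of diameter below \<open>3\<^sup>-\<^sup>m\<close> meets the points of at most three neighbouring triadic
  intervals of level \<open>m\<close>. By the separation hypothesis each of those fixes the first \<open>k\<close> binary
  choices, so the binary numbers formed by the choices lie in three intervals of length \<open>2\<^sup>-\<^sup>k\<close>.\<close>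

lemma level_cover:
  fixes D :: "(nat \<Rightarrow> bool) \<Rightarrow> nat \<Rightarrow> nat" and L N :: nat
  assumes D: "\<And>e i. D e i < 3"
    and sep: "\<And>e e' j k. j < k \<Longrightarrow> e j \<noteq> e' j \<Longrightarrow> \<exists>i<L + k * N. D e i \<noteq> D e' i"
    and U: "bounded U" "diameter U < (1 / 3) ^ m" and k: "k = 0 \<or> L + k * N \<le> m"
  shows "\<exists>C\<in>sets lborel. {beta_val 2 e | e. ternary (D e) \<in> U} \<subseteq> C \<and>
           emeasure lborel C \<le> ennreal (3 / 2 ^ k)"
proof (cases "\<exists>e. ternary (D e) \<in> U")
  case False
  then show ?thesis by (intro bexI[of _ "{}"]) auto
next
  case True
  then obtain e0 where e0: "ternary (D e0) \<in> U" by blast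
  define a where "a = ternary_prefix (D e0) m"
  define F where "F = {a - 1, a, a + 1}"
  define rep where "rep v = (SOME e. ternary_prefix (D e) m = v)" for v
  define s where "s v = (\<Sum>i<k. of_bool (rep v i) / 2 ^ Suc i :: real)" for v
  define C where "C = (\<Union>v\<in>F. {s v..s v + 1 / 2 ^ k})"
  have "beta_val 2 e \<in> C" if e: "ternary (D e) \<in> U" for e
  proof -
    define v where "v = ternary_prefix (D e) m"
    have tail: "ternary (\<lambda>i. D e' (m + i)) \<in> {0..1}" for e'
      by (rule ternary_in_unit_interval) (rule D)
    \<comment> \<open>two points closer than \<open>3\<^sup>-\<^sup>m\<close> lie in the same or in adjacent triadic intervals\<close>
    have "\<bar>ternary (D e) - ternary (D e0)\<bar> < (1 / 3) ^ m"
      using diameter_bounded_bound[OF U(1) e e0] U(2) by (simp add: dist_real_def)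
    then have "3 ^ m * \<bar>ternary (D e) - ternary (D e0)\<bar> < 1"
      by (simp add: power_one_over field_simps)
    then have "\<bar>3 ^ m * ternary (D e) - 3 ^ m * ternary (D e0)\<bar> < 1"
      by (simp add: abs_mult flip: right_diff_distrib)
    then have "\<bar>real v - real a\<bar> < 2"
      using tail[of e] tail[of e0]
        ternary_eq_prefix_add_tail[of "D e" m, OF D] ternary_eq_prefix_add_tail[of "D e0" m, OF D]
      unfolding v_def a_def by auto
    then have "v \<in> F" unfolding F_def by auto
    have rep: "ternary_prefix (D (rep v)) m = v"
      unfolding rep_def by (rule someI[where P = "\<lambda>e. ternary_prefix (D e) m = v"]) (simp add: v_def)
    have agree: "e i = rep v i" if ik: "i < k" for i
    proof (rule ccontr)
      assume "e i \<noteq> rep v i"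
      then obtain l where l: "l < L + k * N" "D e l \<noteq> D (rep v) l" using sep[OF ik, of e "rep v"] by blast
      have "l < m" using k ik l(1) by auto
      moreover have "ternary_prefix (D e) m = ternary_prefix (D (rep v)) m"
        unfolding rep by (simp only: v_def)
      ultimately have "D e l = D (rep v) l"
        using D ternary_prefix_inj[of "D e" "D (rep v)"] by blast
      then show False using l(2) by blast
    qed
    have "beta_val 2 e = s v + beta_val 2 (\<lambda>i. e (k + i)) / 2 ^ k"
      unfolding s_def by (subst beta_val_split[of 2 e k]) (simp_all add: agree)
    moreover have "0 \<le> beta_val 2 (\<lambda>i. e (k + i))" "beta_val 2 (\<lambda>i. e (k + i)) \<le> 1"
      using beta_val_nonneg[of 2] beta_val_le[of 2 "\<lambda>i. e (k + i)"] by auto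
    ultimately have "beta_val 2 e \<in> {s v..s v + 1 / 2 ^ k}"
      by (auto intro!: divide_right_mono)
    then show ?thesis unfolding C_def using \<open>v \<in> F\<close> by blast
  qed
  moreover have "emeasure lborel C \<le> ennreal (3 / 2 ^ k)"
  proof -
    have "finite F" "card F \<le> 3" unfolding F_def by (auto simp: card_insert_if)
    have "emeasure lborel C \<le> (\<Sum>v\<in>F. emeasure lborel {s v..s v + 1 / 2 ^ k})"
      unfolding C_def by (rule emeasure_subadditive_finite) (auto simp: \<open>finite F\<close>)
    also have "\<dots> = (\<Sum>v\<in>F. ennreal (1 / 2 ^ k))" by simp
    also have "\<dots> = ennreal (card F * (1 / 2 ^ k))"
      by (subst sum_ennreal) auto
    also have "\<dots> \<le> ennreal (3 * (1 / 2 ^ k))"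
      using \<open>card F \<le> 3\<close> by (intro ennreal_leI mult_right_mono) auto
    finally show ?thesis by simp
  qed
  moreover have "C \<in> sets lborel" unfolding C_def F_def by simp
  ultimately show ?thesis by blast
qed

text \<open>This picks the scale \<open>m\<close> of a set of diameter \<open>d\<close> and converts \<open>2\<^sup>-\<^sup>k\<close> with
  \<open>k = (m - L) div N\<close> into a power of \<open>d\<close>. The exponent \<open>ln 2 / (N ln 3)\<close> is the one that turns
  \<open>3\<^sup>-\<^sup>N\<close> into \<open>1/2\<close>.\<close>

lemma scale_bound:
  fixes d s :: real and L N :: nat
  assumes N: "0 < N" and s: "s \<le> ln 2 / (N * ln 3)" and d: "0 < d" "d \<le> 1 / 2"
  shows "\<exists>m k. d < (1 / 3) ^ m \<and> (k = 0 \<or> L + k * N \<le> m) \<and>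
    3 / 2 ^ k \<le> 6 * 2 powr (L / N) * d powr s"
proof -
  define s0 where "s0 = ln 2 / (N * ln 3)"
  define P where "P n \<longleftrightarrow> (1 / 3) ^ n \<le> d" for n :: nat
  have "\<exists>n. P n"
    using real_arch_pow_inv[OF d(1), of "1/3"] unfolding P_def by (auto intro: less_imp_le)
  define n where "n = (LEAST n. P n)"
  have Pn: "P n" unfolding n_def using \<open>\<exists>n. P n\<close> by (rule LeastI_ex)
  have "n \<noteq> 0"
  proof
    assume "n = 0" then show False using Pn d by (simp add: P_def)
  qed
  then obtain m where m: "n = Suc m" by (cases n) auto
  have "\<not> P m" using m not_less_Least[of m P] by (simp add: n_def)
  define k where "k = (m - L) div N"
  have "k * N \<le> m - L" by (simp add: k_def div_times_less_eq_dividend)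
  moreover have "0 < k * N" if "k \<noteq> 0" using N that by simp
  ultimately have "k = 0 \<or> L + k * N \<le> m" by linarith
  moreover have "3 / 2 ^ k \<le> 6 * 2 powr (L / N) * d powr s"
  proof -
    have "m - L < (k + 1) * N" using N unfolding k_def
      by (metis Suc_eq_plus1 div_less_iff_less_mult lessI mult.commute)
    then have "m + 1 \<le> (k + 1) * N + L" by linarith
    then have "real (m + 1) \<le> (real k + 1) * N + L"
      by (metis of_nat_1 of_nat_add of_nat_le_iff of_nat_mult)
    then have "(m + 1) / N \<le> ((real k + 1) * N + L) / N" by (intro divide_right_mono) auto
    also have "\<dots> = (real k + 1) + L / N" using N by (simp add: add_divide_distrib)
    finally have "(m + 1) / N \<le> (real k + 1) + L / N" .
    then have "- real k \<le> 1 + L / N + - ((m + 1) / N)" by simp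
    then have "2 powr (- real k) \<le> 2 powr (1 + L / N + - ((m + 1) / N))"
      by (intro powr_mono) auto
    also have "\<dots> = 2 * 2 powr (L / N) * 2 powr (- ((m + 1) / N))"
      by (simp only: powr_add) simp
    also have "2 powr (- ((m + 1) / N)) = ((1 / 3) ^ (m + 1)) powr s0"
      using N by (simp add: powr_def s0_def ln_realpow ln_div del: power_Suc)
    also have "\<dots> \<le> d powr s0"
      using Pn unfolding P_def m s0_def by (intro powr_mono2) (auto simp: ln_ge_zero)
    also have "\<dots> \<le> d powr s" using s d unfolding s0_def by (intro powr_mono') auto
    finally have "2 powr (- real k) \<le> 2 * 2 powr (L / N) * d powr s" by simp
    moreover have "3 / 2 ^ k = 3 * 2 powr (- real k)"
      by (simp add: powr_minus_divide powr_realpow)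
    ultimately show ?thesis by (simp add: mult_ac)
  qed
  moreover have "d < (1 / 3) ^ m" using \<open>\<not> P m\<close> by (simp add: P_def)
  ultimately show ?thesis by blast
qed

text \<open>The binary number formed by the choices runs through all of \<open>[0, 1]\<close>. A cover of \<open>A\<close>
  therefore induces a cover of \<open>[0, 1]\<close>, and Lebesgue measure bounds the sum of the powers of the
  diameters from below. The digits of \<open>D e\<close> up to position \<open>L + k N\<close> determine the first \<open>k\<close>
  choices; the offset \<open>L\<close> leaves room for a common initial word.\<close>

theorem hausdorff_dim_ge_of_tree:
  fixes D :: "(nat \<Rightarrow> bool) \<Rightarrow> nat \<Rightarrow> nat" and L N :: nat
  assumes N: "0 < N" and D: "\<And>e i. D e i < 3"
    and sep: "\<And>e e' j k. j < k \<Longrightarrow> e j \<noteq> e' j \<Longrightarrow> \<exists>i<L + k * N. D e i \<noteq> D e' i"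
    and A: "\<And>e. ternary (D e) \<in> A"
  shows "ereal (ln 2 / (N * ln 3)) \<le> hausdorff_dim A"
proof -
  define K where "K = 6 * 2 powr (L / N)"
  have K: "0 < K" by (simp add: K_def)
  have main: "ennreal (1 / (2 * K)) \<le> (\<Sum>n. ennreal (diameter_powr s (U n)))"
    if s: "0 \<le> s" "s \<le> ln 2 / (N * ln 3)" and cover: "A \<subseteq> (\<Union>n. U n)"
      and U: "\<And>n. bounded (U n)" "\<And>n. diameter (U n) \<le> 1 / 2"
    for s and U :: "nat \<Rightarrow> real set"
  proof -
    define w where "w n = diameter_powr s (U n)" for n
    have w0: "0 \<le> w n" for n by (simp add: w_def diameter_powr_def)
    define S where "S n = {beta_val 2 e | e. ternary (D e) \<in> U n}" for n
    have "\<exists>C. C \<in> sets lborel \<and> S n \<subseteq> C \<and>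
           emeasure lborel C \<le> ennreal (K * w n + (1 / 2) ^ (n + 2))" for n
    proof -
      have scale: "\<exists>m k. diameter (U n) < (1 / 3) ^ m \<and> (k = 0 \<or> L + k * N \<le> m) \<and>
          3 / 2 ^ k \<le> K * w n + (1 / 2) ^ (n + 2)" if ne: "U n \<noteq> {}"
      proof (cases "diameter (U n) = 0")
        case True
        \<comment> \<open>sets of diameter \<open>0\<close> contribute nothing to the sum, so the term \<open>(1/2)\<^sup>n\<^sup>+\<^sup>2\<close> pays for them\<close>
        have "3 / 2 ^ (n + 4) \<le> (1 / 2 :: real) ^ (n + 2)"
          by (simp add: power_add power_one_over field_simps)
        moreover have "0 \<le> K * w n" using w0[of n] K by simp
        ultimately have "3 / 2 ^ (n + 4) \<le> K * w n + (1 / 2) ^ (n + 2)" by linarith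
        then show ?thesis using True
          by (rule_tac exI[of _ "L + (n + 4) * N"], rule_tac exI[of _ "n + 4"]) simp
      next
        case False
        then have pos: "0 < diameter (U n)" using diameter_ge_0[OF U(1)[of n]] by simp
        then have "w n = diameter (U n) powr s"
          using ne by (simp add: w_def diameter_powr_def)
        then obtain m k where "diameter (U n) < (1 / 3) ^ m" "k = 0 \<or> L + k * N \<le> m"
            "3 / 2 ^ k \<le> K * w n"
          using scale_bound[OF N s(2) pos U(2), of L] unfolding K_def by auto
        moreover have "K * w n \<le> K * w n + (1 / 2) ^ (n + 2)" by simp
        ultimately show ?thesis using order_trans by blast
      qed
      show ?thesis
      proof (cases "U n = {}")
        case True
        then show ?thesis by (intro exI[of _ "{}"]) (auto simp: S_def)
      next
        case False
        then obtain m k where mk: "diameter (U n) < (1 / 3) ^ m" "k = 0 \<or> L + k * N \<le> m"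
            "3 / 2 ^ k \<le> K * w n + (1 / 2) ^ (n + 2)"
          using scale[OF False] by blast
        have "\<exists>C\<in>sets lborel. S n \<subseteq> C \<and> emeasure lborel C \<le> ennreal (3 / 2 ^ k)"
          unfolding S_def by (rule level_cover[OF D sep U(1) mk(1,2)])
        then show ?thesis using ennreal_leI[OF mk(3)] by (meson order_trans)
      qed
    qed
    then have "\<forall>n. \<exists>C. C \<in> sets lborel \<and> S n \<subseteq> C \<and>
           emeasure lborel C \<le> ennreal (K * w n + (1 / 2) ^ (n + 2))" by blast
    from choice[OF this] obtain C where "\<forall>n. C n \<in> sets lborel \<and> S n \<subseteq> C n \<and>
           emeasure lborel (C n) \<le> ennreal (K * w n + (1 / 2) ^ (n + 2))" by blast
    then have C: "\<And>n. C n \<in> sets lborel" "\<And>n. S n \<subseteq> C n"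
        "\<And>n. emeasure lborel (C n) \<le> ennreal (K * w n + (1 / 2) ^ (n + 2))" by blast+
    have "{0..1} \<subseteq> (\<Union>n. C n)"
    proof
      fix x :: real assume "x \<in> {0..1}"
      then obtain e where e: "beta_val 2 e = x" using beta_expansion_exists[of 2 x] by auto
      obtain n where "ternary (D e) \<in> U n" using A cover by blast
      then show "x \<in> (\<Union>n. C n)" using C(2)[of n] e unfolding S_def by blast
    qed
    then have "emeasure lborel {0..1::real} \<le> emeasure lborel (\<Union>n. C n)"
      by (intro emeasure_mono sets.countable_UN) (use C(1) in auto)
    also have "\<dots> \<le> (\<Sum>n. emeasure lborel (C n))"
      by (rule emeasure_subadditive_countably) (use C(1) in auto)
    also have "\<dots> \<le> (\<Sum>n. ennreal (K * w n + (1 / 2) ^ (n + 2)))"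
      by (intro suminf_le C(3)) auto
    also have "\<dots> = (\<Sum>n. ennreal K * ennreal (w n) + ennreal ((1 / 2) ^ (n + 2)))"
      using K w0 by (simp add: ennreal_plus ennreal_mult')
    also have "\<dots> = ennreal K * (\<Sum>n. ennreal (w n)) + (\<Sum>n. ennreal ((1 / 2) ^ (n + 2)))"
      by (subst suminf_add[symmetric]) auto
    also have "(\<Sum>n. ennreal ((1 / 2) ^ (n + 2))) = ennreal (1 / 2)"
    proof -
      have "(\<lambda>n. (1/4) * (1 / 2 :: real) ^ n) sums ((1/4) * (1 / (1 - 1/2)))"
        by (intro sums_mult geometric_sums) simp
      then have "(\<lambda>n. (1 / 2 :: real) ^ (n + 2)) sums (1 / 2)"
        by (simp add: power_add field_simps)
      then show ?thesis by (intro suminf_ennreal_eq) auto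
    qed
    finally have le: "1 \<le> ennreal K * (\<Sum>n. ennreal (w n)) + ennreal (1 / 2)" by simp
    show ?thesis
    proof (cases "\<Sum>n. ennreal (w n)")
      case (real r)
      then have "ennreal 1 \<le> ennreal (K * r + 1 / 2)"
        using le K by (simp add: ennreal_plus ennreal_mult')
      then have "1 \<le> K * r + 1 / 2" using K real(1) by (subst (asm) ennreal_le_iff) auto
      then have "1 / (2 * K) \<le> r" using K by (simp add: field_simps)
      then show ?thesis using real by (simp add: w_def ennreal_leI)
    next
      case top
      then show ?thesis by (simp add: w_def)
    qed
  qed
  \<comment> \<open>the scale \<open>1/2\<close> only serves to keep all diameters below \<open>1\<close>\<close>
  have "hausdorff_measure s A \<noteq> 0" if s: "0 \<le> s" "s \<le> ln 2 / (N * ln 3)" for s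
  proof -
    have "ennreal (1 / (2 * K)) \<le> hausdorff_premeasure s (1 / 2) A"
      unfolding hausdorff_premeasure_def by (rule INF_greatest) (use main[OF s] in auto)
    also have "\<dots> \<le> hausdorff_measure s A"
      unfolding hausdorff_measure_def by (rule SUP_upper) simp
    finally show ?thesis using K by (auto simp: ennreal_eq_0_iff)
  qed
  then show ?thesis unfolding hausdorff_dim_def by (intro Inf_greatest) (auto, force)
qed

section \<open>Uniform branching bounds the dimension of all uncountable slices\<close>

definition incomparable :: "'a list \<Rightarrow> 'a list \<Rightarrow> bool" where
  "incomparable u v \<longleftrightarrow> (\<exists>i. i < length u \<and> i < length v \<and> u ! i \<noteq> v ! i)"

text \<open>Concatenating the two words offered at each point of \<open>Y\<close> builds a binary tree of codes, to
  which the previous theorem applies.\<close>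

lemma hausdorff_dim_slice_ge_of_branching:
  fixes N :: nat
  assumes q: "1 < q" "q < 2" and Y: "Y \<subseteq> {0..1}"
    and branch: "\<And>y. y \<in> Y \<Longrightarrow> \<exists>u v. incomparable u v \<and>
      (\<forall>w\<in>{u, v}. set w \<subseteq> {..<3} \<and> length w \<le> N \<and> follow q w y \<in> Y)"
    and w0: "set w0 \<subseteq> {..<3}" "follow q w0 y0 \<in> Y"
  shows "ereal (ln 2 / (N * ln 3)) \<le> hausdorff_dim (slice q y0)"
proof -
  have "\<forall>y. \<exists>uv. y \<in> Y \<longrightarrow> incomparable (fst uv) (snd uv) \<and>
      (\<forall>w\<in>{fst uv, snd uv}. set w \<subseteq> {..<3} \<and> length w \<le> N \<and> follow q w y \<in> Y)"
    using branch by fastforce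
  from choice[OF this] obtain uv where
    uv: "\<And>y. y \<in> Y \<Longrightarrow> incomparable (fst (uv y)) (snd (uv y)) \<and>
      (\<forall>w\<in>{fst (uv y), snd (uv y)}. set w \<subseteq> {..<3} \<and> length w \<le> N \<and> follow q w y \<in> Y)"
    by blast
  define W where "W b y = (if b then fst (uv y) else snd (uv y))" for b y
  have W: "set (W b y) \<subseteq> {..<3}" "length (W b y) \<le> N" "follow q (W b y) y \<in> Y"
    if "y \<in> Y" for b y
    using uv[OF that] by (auto simp: W_def)
  have W_incomparable: "\<exists>i. i < length (W b y) \<and> i < length (W b' y) \<and> W b y ! i \<noteq> W b' y ! i"
    if "y \<in> Y" "b \<noteq> b'" for b b' y
    using uv[OF that(1)] that(2) unfolding incomparable_def W_def by (cases b; cases b') fastforce+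
  have W_nonempty: "0 < length (W b y)" if "y \<in> Y" for b y
    using W_incomparable[OF that, of b "\<not> b"] by auto
  define L where "L = length w0"
  define p where "p e = rec_nat w0 (\<lambda>k w. w @ W (e k) (follow q w y0))" for e
  have p_0: "p e 0 = w0" for e by (simp add: p_def)
  have p_Suc: "p e (Suc k) = p e k @ W (e k) (follow q (p e k) y0)" for e k by (simp add: p_def)
  have p_Y: "follow q (p e k) y0 \<in> Y" for e k
    by (induction k) (use w0 W in \<open>auto simp: p_0 p_Suc\<close>)
  have p_set: "set (p e k) \<subseteq> {..<3}" for e k
  proof (induction k)
    case (Suc k) then show ?case using W(1)[OF p_Y[of e k], of "e k"] by (simp add: p_Suc)
  qed (use w0 in \<open>simp add: p_0\<close>)
  have p_length: "k \<le> length (p e k)" "length (p e k) \<le> L + k * N" for e k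
  proof (induction k)
    case (Suc k)
    show "Suc k \<le> length (p e (Suc k))" "length (p e (Suc k)) \<le> L + Suc k * N"
      using Suc W(2)[OF p_Y[of e k], of "e k"] W_nonempty[OF p_Y[of e k], of "e k"]
      by (simp_all only: p_Suc length_append mult_Suc)
  qed (simp_all add: p_0 L_def)
  have p_prefix: "p e (k + l) ! i = p e k ! i" if "i < length (p e k)" for e k l i
  proof (induction l)
    case (Suc l)
    have "length (p e k) \<le> length (p e (k + l))"
      by (induction l) (simp_all add: p_Suc)
    then show ?case using Suc that by (simp add: p_Suc nth_append)
  qed simp
  define D where "D e i = p e (Suc i) ! i" for e i
  have D_eq: "D e i = p e k ! i" if "i < length (p e k)" for e k i
  proof -
    have "i < length (p e (Suc i))" using p_length(1)[of "Suc i" e] by simp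
    then have "p e (Suc i + k) ! i = D e i" unfolding D_def by (rule p_prefix)
    moreover have "p e (k + Suc i) ! i = p e k ! i" using that by (rule p_prefix)
    ultimately show ?thesis by (simp add: add.commute)
  qed
  have D_less: "D e i < 3" for e i
  proof -
    have "i < length (p e (Suc i))" using p_length(1)[of "Suc i" e] by simp
    then have "D e i \<in> set (p e (Suc i))" unfolding D_def by simp
    then show ?thesis using p_set by blast
  qed
  have code: "slice_code q y0 (D e)" for e
    unfolding slice_code_def
  proof (intro conjI allI)
    show "D e i < 3" for i by (rule D_less)
    fix n
    have "map (D e) [0..<n] = take n (p e n)"
      using p_length(1)[of n e] by (intro nth_equalityI) (auto simp: D_eq[of _ e n])
    moreover have "follow q (drop n (p e n)) (follow q (take n (p e n)) y0) = follow q (p e n) y0"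
      by (metis append_take_drop_id comp_apply fold_append)
    ultimately show "follow q (map (D e) [0..<n]) y0 \<in> {0..1}"
      using follow_in_unit_interval[OF q] p_Y[of e n] Y by (metis subsetD)
  qed
  have sep: "\<exists>i<L + k * N. D e i \<noteq> D e' i" if jk: "j < k" "e j \<noteq> e' j" for e e' j k
  proof -
    define l where "l = (LEAST j. e j \<noteq> e' j)"
    have l: "e l \<noteq> e' l" unfolding l_def using jk(2) by (rule LeastI)
    have "l \<le> j" unfolding l_def using jk(2) by (rule Least_le)
    have "e i = e' i" if "i < l" for i using that not_less_Least unfolding l_def by blast
    then have "p e m = p e' m" if "m \<le> l" for m
      using that by (induction m) (auto simp: p_0 p_Suc)
    then have pl: "p e l = p e' l" by simp
    obtain i where i: "i < length (W (e l) (follow q (p e l) y0))"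
        "i < length (W (e' l) (follow q (p e l) y0))"
        "W (e l) (follow q (p e l) y0) ! i \<noteq> W (e' l) (follow q (p e l) y0) ! i"
      using W_incomparable[OF p_Y l] by blast
    define n where "n = length (p e l) + i"
    have "D e n \<noteq> D e' n"
      using i D_eq[of n e "Suc l"] D_eq[of n e' "Suc l"] pl
      by (simp add: n_def p_Suc nth_append)
    moreover have "n < length (p e (Suc l))" using i by (simp add: n_def p_Suc)
    then have "n < L + Suc l * N" using p_length(2)[of e "Suc l"] by simp
    then have "n < L + k * N"
      using \<open>l \<le> j\<close> \<open>j < k\<close> mult_le_mono1[of "Suc l" k N] by simp
    ultimately show ?thesis by blast
  qed
  have "0 < N" using W(2)[OF w0(2), of True] W_nonempty[OF w0(2), of True] by linarith
  show ?thesis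
  proof (rule hausdorff_dim_ge_of_tree[of N D L])
    show "ternary (D e) \<in> slice q y0" for e
      using code[of e] unfolding slice_eq[OF q] by blast
  qed (fact \<open>0 < N\<close> D_less sep)+
qed

lemma inv_branch_in_unit_interval_iff:
  assumes "1 < q" "q < 2" "d < 3"
  shows "inv_branch q d y \<in> {0..1} \<longleftrightarrow>
    (if d = 0 then 0 \<le> y \<and> y \<le> 1 / q
     else if d = 1 then 1 - 1 / q \<le> y \<and> y \<le> 1 / q else 1 - 1 / q \<le> y \<and> y \<le> 1)"
proof -
  have "0 \<le> q * y \<longleftrightarrow> 0 \<le> y" using assms by (simp add: zero_le_mult_iff)
  moreover have "q * y \<le> 1 \<longleftrightarrow> y \<le> 1 / q" "q - 1 \<le> q * y \<longleftrightarrow> 1 - 1 / q \<le> y"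
    "q * y \<le> q \<longleftrightarrow> y \<le> 1"
    using assms by (auto simp: field_simps)
  ultimately show ?thesis
    using assms by (auto simp: inv_branch_def divide_le_eq zero_le_divide_iff)
qed

text \<open>The core is the interior of \<open>J = [1 - 1/q, 1/q]\<close>. It is taken open so that reaching it is stable under small perturbations of the
  starting point. It suffices to control the final value of the word, since outside the unit
  interval an orbit cannot come back.\<close>

definition reaches_core :: "real \<Rightarrow> real \<Rightarrow> bool" where
  "reaches_core q y \<longleftrightarrow> (\<exists>w. set w \<subseteq> {..<3} \<and> follow q w y \<in> {1 - 1 / q<..<1 / q})"

lemma reaches_coreI: "y \<in> {1 - 1 / q<..<1 / q} \<Longrightarrow> reaches_core q y"
  unfolding reaches_core_def by (intro exI[of _ "[]"]) simp

lemma reaches_core_inv_branch: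
  assumes "d < 3" "reaches_core q (inv_branch q d y)"
  shows "reaches_core q y"
proof -
  obtain w where "set w \<subseteq> {..<3}" "follow q w (inv_branch q d y) \<in> {1 - 1 / q<..<1 / q}"
    using assms(2) unfolding reaches_core_def by blast
  then show ?thesis unfolding reaches_core_def using assms(1)
    by (intro exI[of _ "d # w"]) simp
qed

text \<open>The IFS is symmetric under \<open>y \<mapsto> 1 - y\<close>, which exchanges the digits \<open>0\<close> and \<open>2\<close>.\<close>

lemma inv_branch_reflect:
  assumes "1 < q" "q < 2" "d < 3"
  shows "inv_branch q (2 - d) (1 - y) = 1 - inv_branch q d y"
  using assms(1,2) assms(3)[unfolded less_3_cases]
  by (auto simp: inv_branch_def field_simps)

lemma reaches_core_reflect:
  assumes q: "1 < q" "q < 2" and "reaches_core q y"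
  shows "reaches_core q (1 - y)"
proof -
  obtain w where w: "set w \<subseteq> {..<3}" "follow q w y \<in> {1 - 1 / q<..<1 / q}"
    using assms(3) unfolding reaches_core_def by blast
  have "follow q (map (\<lambda>d. 2 - d) w) (1 - y) = 1 - follow q w y"
    using w(1)
  proof (induction w arbitrary: y)
    case (Cons d w)
    then show ?case using inv_branch_reflect[OF q, of d y] by simp
  qed simp
  then show ?thesis unfolding reaches_core_def using w(2)
    by (intro exI[of _ "map (\<lambda>d. 2 - d) w"]) auto
qed

lemma continuous_on_follow: "continuous_on UNIV (follow q w)"
proof (induction w)
  case (Cons d w)
  have "continuous_on UNIV (inv_branch q d)"
    unfolding inv_branch_def divide_inverse by (cases "d = 0"; cases "d = 1"; simp; intro continuous_intros)
  then show ?case using continuous_on_compose2[OF Cons, of UNIV "inv_branch q d"]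
    by (simp add: comp_def)
qed (simp add: id_def)

text \<open>For an interior point the two good images provide the pair of words. An endpoint of \<open>J\<close> has
  the images \<open>0\<close> and \<open>1\<close>, which are fixed forever; there the third image, \<open>2 - q\<close> or its mirror
  image \<open>q - 1\<close>, leads to an interior point, where the branching takes place. Both words remain
  good in a neighbourhood, and compactness leaves finitely many pairs.\<close>

lemma uniform_branching:
  assumes q: "1 < q" "q < 2"
    and two: "\<And>y. y \<in> {1 - 1 / q<..<1 / q} \<Longrightarrow>
      \<exists>d<3. \<exists>d'<3. d \<noteq> d' \<and> reaches_core q (inv_branch q d y) \<and> reaches_core q (inv_branch q d' y)"
    and endpoint: "reaches_core q (2 - q)"
  obtains N :: nat where "\<And>y. y \<in> {1 - 1 / q..1 / q} \<Longrightarrow> \<exists>u v. incomparable u v \<and>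
      (\<forall>w\<in>{u, v}. set w \<subseteq> {..<3} \<and> length w \<le> N \<and> follow q w y \<in> {1 - 1 / q..1 / q})"
proof -
  define J where "J = {1 - 1 / q<..<1 / q}"
  define R where "R w = follow q w -` J" for w
  define pairs where "pairs = {(u, v :: nat list). incomparable u v \<and> set u \<subseteq> {..<3} \<and> set v \<subseteq> {..<3}}"
  have *: "\<exists>t\<in>pairs. y \<in> R (fst t) \<inter> R (snd t)" if w: "set w \<subseteq> {..<3}" "follow q w y \<in> J" for w y
  proof -
    obtain d d' where d: "d < 3" "d' < 3" "d \<noteq> d'" "reaches_core q (inv_branch q d (follow q w y))"
        "reaches_core q (inv_branch q d' (follow q w y))"
      using two w(2) unfolding J_def by blast
    then obtain u v where u: "set u \<subseteq> {..<3}" "follow q u (inv_branch q d (follow q w y)) \<in> J"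
      and v: "set v \<subseteq> {..<3}" "follow q v (inv_branch q d' (follow q w y)) \<in> J"
      unfolding reaches_core_def J_def by blast
    have "incomparable (w @ d # u) (w @ d' # v)"
      unfolding incomparable_def using d(3) by (intro exI[of _ "length w"]) simp
    then show ?thesis using w u v d
      by (intro bexI[of _ "(w @ d # u, w @ d' # v)"]) (auto simp: pairs_def R_def)
  qed
  have cover: "{1 - 1 / q..1 / q} \<subseteq> (\<Union>t\<in>pairs. R (fst t) \<inter> R (snd t))"
  proof
    fix y assume y: "y \<in> {1 - 1 / q..1 / q}"
    have "\<exists>w. set w \<subseteq> {..<3} \<and> follow q w y \<in> J"
    proof (cases "y \<in> J")
      case True then show ?thesis by (intro exI[of _ "[]"]) simp
    next
      case False
      then consider "y = 1 / q" | "y = 1 - 1 / q" using y by (force simp: J_def)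
      then have "reaches_core q y"
      proof cases
        case 1
        then have "inv_branch q 2 y = 2 - q" using q by (simp add: inv_branch_def)
        then show ?thesis using reaches_core_inv_branch[of 2 q y] endpoint by simp
      next
        case 2
        then have "inv_branch q 0 y = 1 - (2 - q)" using q by (simp add: inv_branch_def field_simps)
        then show ?thesis
          using reaches_core_inv_branch[of 0 q y] reaches_core_reflect[OF q endpoint] by simp
      qed
      then show ?thesis unfolding reaches_core_def J_def .
    qed
    then show "y \<in> (\<Union>t\<in>pairs. R (fst t) \<inter> R (snd t))" using * by blast
  qed
  have "open (R w)" for w
    unfolding R_def J_def by (rule open_vimage[OF open_greaterThanLessThan continuous_on_follow])
  then have opens: "open (R (fst t) \<inter> R (snd t))" for t by (intro open_Int)
  obtain T where T: "T \<subseteq> pairs" "finite T"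
      "{1 - 1 / q..1 / q} \<subseteq> (\<Union>t\<in>T. R (fst t) \<inter> R (snd t))"
    by (rule compactE_image[OF compact_Icc opens cover])
  define N where "N = (\<Sum>t\<in>T. length (fst t) + length (snd t))"
  show ?thesis
  proof (rule that)
    fix y assume "y \<in> {1 - 1 / q..1 / q}"
    then obtain t where t: "t \<in> T" "y \<in> R (fst t)" "y \<in> R (snd t)" using T(3) by blast
    have "length (fst t) + length (snd t) \<le> N"
      unfolding N_def by (rule member_le_sum[OF t(1) _ T(2)]) simp
    moreover have "t \<in> pairs" using t T by blast
    ultimately show "\<exists>u v. incomparable u v \<and>
      (\<forall>w\<in>{u, v}. set w \<subseteq> {..<3} \<and> length w \<le> N \<and> follow q w y \<in> {1 - 1 / q..1 / q})"
      using t(2,3) by (intro exI[of _ "fst t"] exI[of _ "snd t"]) (auto simp: pairs_def R_def J_def)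
  qed
qed

text \<open>Off the interval \<open>J\<close> exactly one digit keeps the orbit in the unit interval.\<close>

lemma slice_subset_singleton_of_avoids:
  assumes q: "1 < q" "q < 2"
    and avoid: "\<And>w. set w \<subseteq> {..<3} \<Longrightarrow> follow q w y \<notin> {1 - 1 / q..1 / q}"
  shows "\<exists>x. slice q y \<subseteq> {x}"
proof -
  have "d i = e i" if d: "slice_code q y d" and e: "slice_code q y e" for d e i
  proof (induction i rule: less_induct)
    case (less i)
    define w where "w = map d [0..<i]"
    have w: "w = map e [0..<i]" using less by (simp add: w_def)
    have "set w \<subseteq> {..<3}" using d by (auto simp: w_def slice_code_def)
    then have av: "follow q w y \<notin> {1 - 1 / q..1 / q}" by (rule avoid)
    have "follow q (map d [0..<Suc i]) y \<in> {0..1}" "follow q (map e [0..<Suc i]) y \<in> {0..1}"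
      using d e unfolding slice_code_def by blast+
    then have in01: "inv_branch q (d i) (follow q w y) \<in> {0..1}"
      "inv_branch q (e i) (follow q w y) \<in> {0..1}"
      by (simp_all add: w_def) (simp add: w flip: w_def)
    have "d i < 3" "e i < 3" using d e by (auto simp: slice_code_def)
    then show ?case
      using av in01[unfolded inv_branch_in_unit_interval_iff[OF q \<open>d i < 3\<close>]
          inv_branch_in_unit_interval_iff[OF q \<open>e i < 3\<close>]]
      unfolding atLeastAtMost_iff less_3_cases by (elim disjE) simp_all
  qed
  then have "d = e" if "slice_code q y d" "slice_code q y e" for d e using that by blast
  then show ?thesis unfolding slice_eq[OF q] by (cases "\<exists>d. slice_code q y d") auto
qed

theorem uniform_dim_bound_of_branching:
  assumes q: "1 < q" "q < 2"
    and two: "\<And>y. y \<in> {1 - 1 / q<..<1 / q} \<Longrightarrow>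
      \<exists>d<3. \<exists>d'<3. d \<noteq> d' \<and> reaches_core q (inv_branch q d y) \<and> reaches_core q (inv_branch q d' y)"
    and endpoint: "reaches_core q (2 - q)"
  shows "\<exists>s::real. s > 0 \<and> (\<forall>y. uncountable (slice q y) \<longrightarrow> ereal s \<le> hausdorff_dim (slice q y))"
proof -
  let ?J = "{1 - 1 / q..1 / q}"
  obtain N where N: "\<And>y. y \<in> ?J \<Longrightarrow> \<exists>u v. incomparable u v \<and>
      (\<forall>w\<in>{u, v}. set w \<subseteq> {..<3} \<and> length w \<le> N \<and> follow q w y \<in> ?J)"
    using uniform_branching[OF q two endpoint] by blast
  have J: "?J \<subseteq> {0..1}" using q by (auto simp: field_simps)
  have "1 / q \<in> ?J" using q by (simp add: field_simps)
  from N[OF this] have "0 < N" by (fastforce simp: incomparable_def)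
  then have "0 < ln 2 / (real N * ln 3)" by simp
  moreover have "ereal (ln 2 / (N * ln 3)) \<le> hausdorff_dim (slice q y)"
    if "uncountable (slice q y)" for y
  proof -
    have "\<exists>w. set w \<subseteq> {..<3} \<and> follow q w y \<in> ?J"
    proof (rule ccontr)
      assume "\<not> ?thesis"
      then obtain x where "slice q y \<subseteq> {x}"
        using slice_subset_singleton_of_avoids[OF q, of y] by blast
      then have "countable (slice q y)" using countable_subset by blast
      then show False using that by simp
    qed
    then show ?thesis using hausdorff_dim_slice_ge_of_branching[OF q J N] by blast
  qed
  ultimately show ?thesis by blast
qed

section \<open>Bases below 1.65\<close>

text \<open>The pair of digits \<open>1, 2\<close> at \<open>y\<close> is the pair \<open>1, 0\<close> at \<open>1 - y\<close>.\<close>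

lemma two_branches_reach:
  assumes q: "1 < q" "q < 2"
    and 02: "\<And>y. y \<in> {1 - 1 / q<..<1 / q} \<Longrightarrow>
      reaches_core q (q * y) \<or> reaches_core q (q * y - (q - 1))"
    and 01: "\<And>y. y \<in> {1 - 1 / q<..<1 / q} \<Longrightarrow>
      reaches_core q (q * y) \<or> reaches_core q ((1 - q * y) / (2 - q))"
    and y: "y \<in> {1 - 1 / q<..<1 / q}"
  shows "\<exists>d<3. \<exists>d'<3. d \<noteq> d' \<and> reaches_core q (inv_branch q d y) \<and> reaches_core q (inv_branch q d' y)"
proof -
  let ?r = "\<lambda>d. reaches_core q (inv_branch q d y)"
  have "?r 0 \<or> ?r 2" "?r 0 \<or> ?r 1" using 02[OF y] 01[OF y] by (simp_all add: inv_branch_def)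
  moreover have "?r 1 \<or> ?r 2"
  proof -
    have "1 - y \<in> {1 - 1 / q<..<1 / q}" using y by auto
    from 01[OF this] have "reaches_core q (inv_branch q (2 - 2) (1 - y)) \<or>
        reaches_core q (inv_branch q (2 - 1) (1 - y))"
      by (simp add: inv_branch_def)
    then have "reaches_core q (1 - inv_branch q 2 y) \<or> reaches_core q (1 - inv_branch q 1 y)"
      using inv_branch_reflect[OF q, of 2 y] inv_branch_reflect[OF q, of 1 y] by simp
    then show ?thesis
      using reaches_core_reflect[OF q, of "1 - inv_branch q 2 y"]
        reaches_core_reflect[OF q, of "1 - inv_branch q 1 y"] by auto
  qed
  moreover have "(0::nat) < 3" "(1::nat) < 3" "(2::nat) < 3" "(0::nat) \<noteq> 1" "(0::nat) \<noteq> 2" "(1::nat) \<noteq> 2"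
    by simp_all
  ultimately show ?thesis by metis
qed

lemma reaches_core_mult: "reaches_core q (q * y) \<Longrightarrow> reaches_core q y"
  using reaches_core_inv_branch[of 0 q y] by (simp add: inv_branch_def)

lemma reaches_core_power: "reaches_core q (q ^ k * y) \<Longrightarrow> reaches_core q y"
proof (induction k)
  case (Suc k)
  then show ?case using reaches_core_mult[of q "q ^ k * y"] by (simp add: mult.assoc)
qed simp

text \<open>Passing through an endpoint of \<open>J\<close> does not help to avoid the core, because the orbit may
  continue with \<open>2 - q\<close> or \<open>q - 1\<close>.\<close>

lemma avoiding_core_cases:
  assumes q: "1 < q" "q < 2" and endpoint: "reaches_core q (2 - q)" and "\<not> reaches_core q y"
  shows "y < 1 - 1 / q \<or> 1 / q < y"
proof (rule ccontr)
  assume "\<not> ?thesis"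
  moreover have "y \<notin> {1 - 1 / q<..<1 / q}" using assms(4) reaches_coreI by blast
  ultimately consider "y = 1 - 1 / q" | "y = 1 / q" by force
  then show False
  proof cases
    case 1
    then have "q * y = 1 - (2 - q)" using q by (simp add: field_simps)
    then show ?thesis
      using reaches_core_reflect[OF q endpoint] reaches_core_mult[of q y] assms(4) by simp
  next
    case 2
    then have "inv_branch q 2 y = 2 - q" using q by (simp add: inv_branch_def)
    then show ?thesis using reaches_core_inv_branch[of 2 q y] endpoint assms(4) by simp
  qed
qed

text \<open>Near \<open>0\<close> only the branch \<open>y \<mapsto> q y\<close> is available. The first power that gets past
  \<open>1 - 1/q\<close> jumps over \<open>J\<close> and lands below \<open>q - 1\<close>.\<close>

lemma avoiding_core_lower_half:
  assumes q: "1 < q" "q < 2" and endpoint: "reaches_core q (2 - q)"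
    and y: "0 < y" "y < 1 - 1 / q" "\<not> reaches_core q y"
  shows "\<exists>k z. y = z / q ^ k \<and> 1 / q < z \<and> z < q - 1 \<and> \<not> reaches_core q z"
proof -
  define Q where "Q k \<longleftrightarrow> 1 - 1 / q \<le> q ^ k * y" for k :: nat
  obtain n where "(1 - 1 / q) / y < q ^ n" using real_arch_pow[OF q(1)] by blast
  then have "Q n" unfolding Q_def using y(1) by (simp add: pos_divide_less_eq)
  define k where "k = (LEAST k. Q k)"
  have "Q k" unfolding k_def using \<open>Q n\<close> by (rule LeastI)
  have "k \<noteq> 0"
  proof
    assume "k = 0" then show False using \<open>Q k\<close> y(2) by (simp add: Q_def)
  qed
  then obtain l where l: "k = Suc l" by (cases k) auto
  have "\<not> Q l" using l not_less_Least[of l Q] by (simp add: k_def)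
  then have "q * (q ^ l * y) < q * (1 - 1 / q)"
    unfolding Q_def using q by (intro mult_strict_left_mono) auto
  then have "q ^ k * y < q - 1" using q by (simp add: l right_diff_distrib mult.assoc)
  moreover have not: "\<not> reaches_core q (q ^ k * y)" using y(3) reaches_core_power by blast
  moreover have "1 / q < q ^ k * y"
    using avoiding_core_cases[OF q endpoint not] \<open>Q k\<close> by (auto simp: Q_def)
  ultimately show ?thesis using q by (intro exI[of _ k] exI[of _ "q ^ k * y"]) simp
qed

lemma avoiding_core_form:
  assumes q: "1 < q" "q < 2" and endpoint: "reaches_core q (2 - q)"
    and y: "0 < y" "y < 1" "\<not> reaches_core q y"
  shows "\<exists>k z. (y = z / q ^ k \<or> y = 1 - z / q ^ k) \<and>
    1 / q < z \<and> z < q - 1 \<and> \<not> reaches_core q z"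
  using avoiding_core_cases[OF q endpoint y(3)]
proof
  assume "y < 1 - 1 / q"
  then show ?thesis using avoiding_core_lower_half[OF q endpoint y(1) _ y(3)] by blast
next
  assume "1 / q < y"
  have "\<not> reaches_core q (1 - y)" using reaches_core_reflect[OF q, of "1 - y"] y(3) by auto
  then obtain k z where "1 - y = z / q ^ k" "1 / q < z" "z < q - 1" "\<not> reaches_core q z"
    using avoiding_core_lower_half[OF q endpoint, of "1 - y"] y \<open>1 / q < y\<close> by auto
  then show ?thesis by (intro exI[of _ k] exI[of _ z]) auto
qed

text \<open>Below the golden ratio \<open>q - 1 < 1/q\<close>, so there is no room to jump over \<open>J\<close>; moreover
  \<open>2 - q\<close> already lies in the core.\<close>

lemma branching_below_golden_ratio:
  assumes q: "1 < q" "q\<^sup>2 < q + 1"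
  shows "reaches_core q (2 - q)"
    and "y \<in> {0<..<1} \<Longrightarrow> reaches_core q y"
proof -
  have "q < 2"
  proof (rule ccontr)
    assume "\<not> q < 2"
    then have "2 * q \<le> q * q" by (intro mult_right_mono) auto
    then show False using q unfolding power2_eq_square by linarith
  qed
  have "0 < (q - 1) * (q - 1)" using q by simp
  then show endpoint: "reaches_core q (2 - q)"
    by (intro reaches_coreI) (use q in \<open>auto simp: field_simps power2_eq_square\<close>)
  have "q - 1 < 1 / q" using q by (simp add: field_simps power2_eq_square)
  then show "reaches_core q y" if "y \<in> {0<..<1}"
    using avoiding_core_form[OF q(1) \<open>q < 2\<close> endpoint, of y] that by force
qed

text \<open>The value \<open>1.65\<close> is a round number slightly above \<open>q_aleph0\<close>, which is about \<open>1.6454\<close>.\<close>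

locale above_golden_ratio =
  fixes q :: real
  assumes above: "1 < q" "q + 1 < q\<^sup>2" and below: "q < 1.65"
begin

lemma q_bounds: "1 < q" "q < 2" "1.6 < q"
proof -
  show "1 < q" "q < 2" using above below by auto
  show "1.6 < q"
  proof (rule ccontr)
    assume "\<not> 1.6 < q"
    then have "q * (q - 1) \<le> 1.6 * 0.6" using above by (intro mult_mono) auto
    then show False using above by (simp add: power2_eq_square algebra_simps)
  qed
qed

lemma q_2_minus_q: "0.5775 < q * (2 - q)" "q * (2 - q) < 0.65"
proof -
  have "0 < (33/20 - q) * (q - 7/20)" "0 < (q - 8/5) * (q - 2/5)"
    using q_bounds below by (auto intro!: mult_pos_pos)
  then have "231/400 < q * (2 - q)" "q * (2 - q) < 13/20"
    unfolding left_diff_distrib right_diff_distrib by linarith+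
  then show "0.5775 < q * (2 - q)" "q * (2 - q) < 0.65" by simp_all
qed

text \<open>This is what sends orbits that leave \<open>(1/q, q - 1)\<close> by \<open>T\<^sub>2\<close> past the left end of the core
  after one more step.\<close>

lemma core_left_end_less: "1 - 1 / q < q * (2 - q)"
proof -
  have "1 / 1.65 < 1 / q" using below q_bounds by (intro divide_strict_left_mono) auto
  then show ?thesis using q_2_minus_q by simp
qed

lemma endpoint_reaches_core: "reaches_core q (2 - q)"
proof (rule reaches_core_mult, rule reaches_coreI)
  have "q * (q * (2 - q)) < 1"
  proof -
    have "0 < (q - 1) * (q\<^sup>2 - q - 1)" using above by simp
    then show ?thesis by (simp add: power2_eq_square algebra_simps)
  qed
  then have "q * (2 - q) < 1 / q" using q_bounds by (simp add: field_simps)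
  then show "q * (2 - q) \<in> {1 - 1 / q<..<1 / q}" using core_left_end_less by simp
qed

definition P :: real where "P = q / (q + 1)"

text \<open>From the gap \<open>(1/q, q - 1)\<close> an orbit that avoids the core is forced back into the gap after
  two steps. The composition of the two steps multiplies the distance to its fixed point \<open>P\<close> by
  \<open>q\<^sup>2\<close>, so only \<open>P\<close> itself can stay in the gap forever.\<close>

lemma avoiding_core_eq_P:
  assumes z: "1 / q < z" "z < q - 1" "\<not> reaches_core q z"
  shows "z = P"
proof -
  let ?A = "\<lambda>z. 1 / q < z \<and> z < q - 1 \<and> \<not> reaches_core q z"
  define f where "f z = q * (q * z - (q - 1))" for z
  have step: "?A (f z)" if "?A z" for z
  proof -
    define w where "w = q * z - (q - 1)"
    have w: "\<not> reaches_core q w"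
      using that reaches_core_inv_branch[of 2 q z] by (auto simp: w_def inv_branch_def)
    have f: "\<not> reaches_core q (f z)" using w reaches_core_mult unfolding f_def w_def by blast
    have "1 < q * z" using that q_bounds by (simp add: field_simps)
    then have "q * (2 - q) < f z" unfolding f_def using q_bounds by (intro mult_strict_left_mono) auto
    then have "1 / q < f z"
      using core_left_end_less avoiding_core_cases[OF q_bounds(1,2) endpoint_reaches_core f] by linarith
    have "w < 1 - 1 / q"
    proof -
      have "q * z < q * (q - 1)" using that q_bounds by (intro mult_strict_left_mono) auto
      then have "w < (q - 1) * (q - 1)" by (simp add: w_def algebra_simps)
      also have "\<dots> < 0.65 * 0.65" using below q_bounds by (intro mult_strict_mono) auto
      also have "\<dots> < 1 / 1.65" by simp
      also have "\<dots> < 1 / q" using below q_bounds by (intro divide_strict_left_mono) auto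
      finally show ?thesis
        using avoiding_core_cases[OF q_bounds(1,2) endpoint_reaches_core w] by linarith
    qed
    then have "q * w < q * (1 - 1 / q)" using q_bounds by (intro mult_strict_left_mono) auto
    then have "f z < q - 1" using q_bounds by (simp add: f_def w_def right_diff_distrib)
    then show ?thesis using f \<open>1 / q < f z\<close> by blast
  qed
  have iter: "?A ((f ^^ n) z)" for n
    by (induction n) (use z step in \<open>auto simp del: not_less\<close>)
  have dist: "(f ^^ n) z - P = (q ^ 2) ^ n * (z - P)" for n
  proof (induction n)
    case (Suc n)
    have "f w - P = q\<^sup>2 * (w - P)" for w
      using q_bounds by (simp add: f_def P_def field_simps power2_eq_square)
    then show ?case using Suc by simp
  qed simp
  show ?thesis
  proof (rule ccontr)
    assume "z \<noteq> P"
    have "1 < q ^ 2" using q_bounds by (simp add: one_less_power)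
    then obtain n where n: "1 / \<bar>z - P\<bar> < (q ^ 2) ^ n" using real_arch_pow by blast
    then have "1 < (q ^ 2) ^ n * \<bar>z - P\<bar>" using \<open>z \<noteq> P\<close> by (simp add: field_simps)
    then have "1 < \<bar>(f ^^ n) z - P\<bar>" unfolding dist by (simp add: abs_mult)
    moreover have "0 < P" "P < 1" using q_bounds by (auto simp: P_def)
    moreover have "0 < 1 / q" using q_bounds by simp
    then have "0 < (f ^^ n) z" "(f ^^ n) z < 1" using iter[of n] q_bounds by linarith+
    ultimately show False by linarith
  qed
qed

lemma P_pos: "0 < P" and P_less: "P < q - 1" and P_reflect: "1 - P = P / q"
  using q_bounds above by (auto simp: P_def field_simps power2_eq_square)

lemma P_div: "2 - q < P / q"
proof -
  have "(2 - q) * (q + 1) < 1" using above by (simp add: power2_eq_square algebra_simps)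
  then have "2 - q < 1 / (q + 1)" using q_bounds by (simp add: pos_less_divide_eq)
  then show ?thesis using q_bounds by (simp add: P_def)
qed

lemma P_div_power_le: "k \<le> l \<Longrightarrow> P / q ^ l \<le> P / q ^ k"
  using P_pos q_bounds by (intro divide_left_mono power_increasing mult_pos_pos) auto

text \<open>The branch \<open>T\<^sub>0\<close> maps the core onto \<open>(q - 1, 1)\<close>. All points \<open>P / q\<^sup>k\<close> are too small for
  this interval, and so are \<open>1 - P\<close> and \<open>1 - P / q\<close>.\<close>

lemma avoiding_core_near_1:
  assumes "q - 1 < u" "u < 1" "\<not> reaches_core q u"
  obtains j where "2 \<le> j" "u = 1 - P / q ^ j"
proof -
  obtain k where "u = P / q ^ k \<or> u = 1 - P / q ^ k"
    using avoiding_core_form[OF q_bounds(1,2) endpoint_reaches_core _ assms(2,3)]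
      avoiding_core_eq_P assms(1) q_bounds by force
  moreover have "P / q ^ k \<le> P" using P_div_power_le[of 0 k] by simp
  ultimately have u: "u = 1 - P / q ^ k" using assms(1) P_less by linarith
  have "2 \<le> k"
  proof (rule ccontr)
    assume "\<not> 2 \<le> k"
    then have "P / q ^ 1 \<le> P / q ^ k" by (intro P_div_power_le) simp
    then show False using u assms(1) P_div by simp
  qed
  then show ?thesis using u that by blast
qed

lemma avoiding_core_near_0:
  assumes "0 < v" "v < 2 - q" "\<not> reaches_core q v"
  obtains j where "2 \<le> j" "v = P / q ^ j"
proof -
  have "\<not> reaches_core q (1 - v)"
    using reaches_core_reflect[OF q_bounds(1,2), of "1 - v"] assms by auto
  then show ?thesis using avoiding_core_near_1[of "1 - v"] assms that by auto
qed

lemma P_div_2: "P / q\<^sup>2 = 1 / (q * (q + 1))"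
  using q_bounds by (simp add: P_def power2_eq_square)

lemma cubic: "q\<^sup>2 * (2 - q) < 1" "1 < q ^ 3 * (2 - q)"
proof -
  have "0 < (q - 1) * (q\<^sup>2 - q - 1)" using above by simp
  then show "q\<^sup>2 * (2 - q) < 1" by (simp add: power2_eq_square algebra_simps)
  have "2.6 * 0.5775 < q\<^sup>2 * (q * (2 - q))"
    using above q_bounds q_2_minus_q by (intro mult_strict_mono) auto
  then show "1 < q ^ 3 * (2 - q)" by (simp add: power2_eq_square power3_eq_cube algebra_simps)
qed

lemma quadratic: "0.9275 < (2 - q) * (q + 1)"
proof -
  have "0 < (33/20 - q) * (q + 13/20)" using q_bounds below by (auto intro!: mult_pos_pos)
  then have "371/400 < (2 - q) * (q + 1)"
    unfolding left_diff_distrib right_diff_distrib distrib_left by linarith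
  then show ?thesis by simp
qed

text \<open>The values of the sum jump over \<open>2 - q\<close>: the exponents \<open>(2, 3)\<close> give \<open>1 / q\<^sup>2 > 2 - q\<close>, while
  \<open>(2, 4)\<close> and \<open>(3, 3)\<close> already give less.\<close>

lemma P_powers_sum_ne:
  assumes "2 \<le> i" "i \<le> j"
  shows "P / q ^ i + P / q ^ j \<noteq> 2 - q"
proof -
  have r: "P / q ^ 2 + P / q ^ 3 = 1 / q\<^sup>2"
  proof -
    have "P / q ^ 2 + P / q ^ 3 = P * (q + 1) / q ^ 3"
      using q_bounds by (simp add: field_simps power2_eq_square power3_eq_cube)
    also have "P * (q + 1) = q" using q_bounds by (simp add: P_def)
    finally show ?thesis by (simp add: power2_eq_square power3_eq_cube)
  qed
  have inv: "2 - q < 1 / q\<^sup>2" using cubic(1) q_bounds by (simp add: field_simps)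
  consider "i = 2" "j \<le> 3" | "i = 2" "4 \<le> j" | "3 \<le> i" using assms by linarith
  then show ?thesis
  proof cases
    case 1
    then show ?thesis using r inv P_div_power_le[of j 3] by simp
  next
    case 2
    have "P / q ^ 2 + P / q ^ 4 < 2 - q"
    proof -
      have q2: "q\<^sup>2 < 2.7225" using below q_bounds power_strict_mono[of q "1.65" 2] by (simp add: power2_eq_square)
      have "q\<^sup>2 * (q\<^sup>2 - 2) < 2.7225 * 0.7225"
        using q2 above q_bounds by (intro mult_strict_mono) auto
      then have "q\<^sup>2 * (q\<^sup>2 - 2) < q + 1" using q_bounds by simp
      then have "0 < (q - 1) * (q + 1 - q\<^sup>2 * (q\<^sup>2 - 2))" using q_bounds by simp
      also have "\<dots> = (2 - q) * (q ^ 3 * (q + 1)) - (q\<^sup>2 + 1)"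
        by (simp add: power2_eq_square power3_eq_cube algebra_simps)
      finally have "(q\<^sup>2 + 1) / (q ^ 3 * (q + 1)) < 2 - q"
        using q_bounds by (simp add: pos_divide_less_eq)
      moreover have "P / q ^ 2 + P / q ^ 4 = (q\<^sup>2 + 1) / (q ^ 3 * (q + 1))"
      proof -
        have "P / q ^ 2 + P / q ^ 4 = P * (q\<^sup>2 + 1) / q ^ 4"
          using q_bounds by (simp add: field_simps eval_nat_numeral)
        also have "\<dots> = (q\<^sup>2 + 1) / (q ^ 3 * (q + 1))"
          using q_bounds by (simp add: P_def eval_nat_numeral mult_ac)
        finally show ?thesis .
      qed
      ultimately show ?thesis by simp
    qed
    then show ?thesis using 2 P_div_power_le[of 4 j] by simp
  next
    case 3
    have "2 * (P / q ^ 3) < 2 - q"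
    proof -
      have "2.6 * 0.9275 < q\<^sup>2 * ((2 - q) * (q + 1))"
        using above q_bounds quadratic by (intro mult_strict_mono) auto
      then have "2 < (2 - q) * (q\<^sup>2 * (q + 1))" by (simp add: algebra_simps)
      then have "2 / (q\<^sup>2 * (q + 1)) < 2 - q" using q_bounds by (simp add: pos_divide_less_eq)
      moreover have "2 * (P / q ^ 3) = 2 / (q\<^sup>2 * (q + 1))"
        using q_bounds by (simp add: P_def eval_nat_numeral)
      ultimately show ?thesis by simp
    qed
    moreover have "P / q ^ i \<le> P / q ^ 3" "P / q ^ j \<le> P / q ^ 3"
      using 3 assms by (auto intro!: P_div_power_le)
    ultimately show ?thesis by linarith
  qed
qed

text \<open>Equality would mean \<open>q\<^sup>n (2 - q) = 1\<close> for \<open>n = j - i\<close>, but the left side is below \<open>1\<close> for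
  \<open>n = 2\<close> and above \<open>1\<close> for \<open>n = 3\<close>. At the golden ratio \<open>n = 2\<close> gives equality.\<close>

lemma power_mult_2_minus_q_ne: "q ^ j * (2 - q) \<noteq> q ^ i"
proof
  assume eq: "q ^ j * (2 - q) = q ^ i"
  have "i \<le> j"
  proof (rule ccontr)
    assume "\<not> i \<le> j"
    then have "q ^ j \<le> q ^ i" using q_bounds by (intro power_increasing) auto
    moreover have "q ^ j * (2 - q) < q ^ j * 1" using q_bounds by (intro mult_strict_left_mono) auto
    ultimately show False using eq by simp
  qed
  define n where "n = j - i"
  have "q ^ i * (q ^ n * (2 - q)) = q ^ i * 1"
    using eq \<open>i \<le> j\<close> by (simp add: n_def flip: mult.assoc power_add)
  then have n: "q ^ n * (2 - q) = 1" using q_bounds by simp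
  show False
  proof (cases "n \<le> 2")
    case True
    then have "q ^ n * (2 - q) \<le> q\<^sup>2 * (2 - q)"
      using q_bounds by (intro mult_right_mono power_increasing) auto
    then show False using n cubic(1) by simp
  next
    case False
    then have "q ^ 3 * (2 - q) \<le> q ^ n * (2 - q)"
      using q_bounds by (intro mult_right_mono power_increasing) auto
    then show False using n cubic(2) by simp
  qed
qed

text \<open>If neither image reaches the core, both are of the special form, and
  \<open>T\<^sub>0 y - T\<^sub>2 y = q - 1\<close> becomes \<open>P / q\<^sup>i + P / q\<^sup>j = 2 - q\<close>.\<close>

lemma outer_branches_reach:
  assumes y: "y \<in> {1 - 1 / q<..<1 / q}"
  shows "reaches_core q (q * y) \<or> reaches_core q (q * y - (q - 1))"
proof (rule ccontr)
  assume "\<not> ?thesis"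
  then have not: "\<not> reaches_core q (q * y)" "\<not> reaches_core q (q * y - (q - 1))" by simp_all
  have u: "q - 1 < q * y" "q * y < 1" using y q_bounds by (auto simp: field_simps)
  obtain i where i: "2 \<le> i" "q * y = 1 - P / q ^ i"
    by (rule avoiding_core_near_1[OF u not(1)])
  have "0 < q * y - (q - 1)" "q * y - (q - 1) < 2 - q" using u by simp_all
  then obtain j where "2 \<le> j" "q * y - (q - 1) = P / q ^ j"
    by (rule avoiding_core_near_0[OF _ _ not(2)])
  then show False
    using i P_powers_sum_ne[of i j] P_powers_sum_ne[of j i] by (cases "i \<le> j") auto
qed

text \<open>Here \<open>1 - T\<^sub>0 y = P / q\<^sup>j\<close> and \<open>T\<^sub>1 y = P / (q\<^sup>j (2 - q))\<close>. The latter is not of the form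
  \<open>P / q\<^sup>i\<close>, and for \<open>i, j \<ge> 2\<close> it is too small to equal \<open>1 - P / q\<^sup>i\<close>; the cases \<open>i < 2\<close> reduce
  to the first form by \<open>1 - P = P / q\<close>.\<close>

lemma adjacent_branches_reach:
  assumes y: "y \<in> {1 - 1 / q<..<1 / q}"
  shows "reaches_core q (q * y) \<or> reaches_core q ((1 - q * y) / (2 - q))"
proof (rule ccontr)
  assume "\<not> ?thesis"
  then have not: "\<not> reaches_core q (q * y)" "\<not> reaches_core q ((1 - q * y) / (2 - q))" by simp_all
  have u: "q - 1 < q * y" "q * y < 1" using y q_bounds by (auto simp: field_simps)
  obtain j where j: "2 \<le> j" "q * y = 1 - P / q ^ j"
    by (rule avoiding_core_near_1[OF u not(1)])
  define v where "v = (1 - q * y) / (2 - q)"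
  have v: "v = P / (q ^ j * (2 - q))" unfolding v_def j(2) by simp
  have "0 < v" "v < 1" unfolding v_def using u q_bounds by auto
  then obtain i where "v = P / q ^ i \<or> v = 1 - P / q ^ i"
    using avoiding_core_form[OF q_bounds(1,2) endpoint_reaches_core, of v] avoiding_core_eq_P not
    unfolding v_def by blast
  moreover have ne: "v \<noteq> P / q ^ i" for i
  proof
    assume "v = P / q ^ i"
    then have "q ^ j * (2 - q) = q ^ i" using P_pos q_bounds unfolding v by (simp add: field_simps)
    then show False using power_mult_2_minus_q_ne by blast
  qed
  ultimately have vi: "v = 1 - P / q ^ i" by blast
  have "2 \<le> i"
  proof (rule ccontr)
    assume "\<not> 2 \<le> i"
    then consider "i = 0" | "i = 1" by linarith
    then show False
      using vi ne[of 1] ne[of 0] P_reflect by cases simp_all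
  qed
  have "P / q\<^sup>2 / (2 - q) + P / q\<^sup>2 < 1"
  proof -
    have "0.9275 * 1.6 < ((2 - q) * (q + 1)) * q"
      using quadratic q_bounds by (intro mult_strict_mono) auto
    then have "3 - q < (2 - q) * (q * (q + 1))" using q_bounds by (simp add: algebra_simps)
    then have "(3 - q) / ((2 - q) * (q * (q + 1))) < 1" using q_bounds by (simp add: divide_less_eq)
    moreover have "P / q\<^sup>2 / (2 - q) + P / q\<^sup>2 = (3 - q) / ((2 - q) * (q * (q + 1)))"
    proof -
      have "P / q\<^sup>2 / (2 - q) + P / q\<^sup>2 = P / q\<^sup>2 * (1 / (2 - q) + 1)" by (simp add: algebra_simps)
      also have "1 / (2 - q) + 1 = (3 - q) / (2 - q)" using q_bounds by (simp add: field_simps)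
      finally show ?thesis unfolding P_div_2 by (simp add: mult_ac)
    qed
    ultimately show ?thesis by simp
  qed
  moreover have "P / q ^ j / (2 - q) \<le> P / q\<^sup>2 / (2 - q)"
    using j P_div_power_le[of 2 j] q_bounds by (intro divide_right_mono) auto
  moreover have "P / q ^ i \<le> P / q\<^sup>2" using \<open>2 \<le> i\<close> by (rule P_div_power_le)
  moreover have "v = P / q ^ j / (2 - q)" unfolding v by simp
  ultimately show False using vi by linarith
qed

end

lemma golden_ratio_iff:
  assumes "1 < q"
  shows "q < golden_ratio \<longleftrightarrow> q\<^sup>2 < q + 1" "golden_ratio < q \<longleftrightarrow> q + 1 < q\<^sup>2"
proof -
  have "golden_ratio\<^sup>2 = golden_ratio + 1"
    by (simp add: golden_ratio_def power2_eq_square field_simps)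
  then have eq: "q\<^sup>2 - (q + 1) = (q - golden_ratio) * (q + golden_ratio - 1)"
    by (simp add: power2_eq_square algebra_simps)
  have "1 < sqrt 5" by simp
  then have "1 < golden_ratio" by (simp add: golden_ratio_def)
  then have pos: "0 < q + golden_ratio - 1" using assms by simp
  have "q\<^sup>2 - (q + 1) < 0 \<longleftrightarrow> q < golden_ratio" "0 < q\<^sup>2 - (q + 1) \<longleftrightarrow> golden_ratio < q"
    unfolding eq using pos by (auto simp: mult_less_0_iff zero_less_mult_iff)
  then show "q < golden_ratio \<longleftrightarrow> q\<^sup>2 < q + 1" "golden_ratio < q \<longleftrightarrow> q + 1 < q\<^sup>2"
    by linarith+
qed

text \<open>Dividing the equation by \<open>x\<^sup>6\<close> turns it into \<open>g x = 1\<close> for a decreasing function \<open>g\<close>, so its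
  root is unique; the sign of the polynomial at \<open>1.65\<close> locates it.\<close>

lemma q_aleph0_bounds: "1 < q_aleph0" "q_aleph0 < 1.65"
proof -
  define f where "f x = x ^ 6 - (x ^ 4 + x ^ 3 + 2 * x ^ 2 + x + 1)" for x :: real
  define g where "g x = 1 / x ^ 2 + 1 / x ^ 3 + 2 / x ^ 4 + 1 / x ^ 5 + 1 / x ^ 6" for x :: real
  have fg: "f x = x ^ 6 * (1 - g x)" if "0 < x" for x
    using that by (simp add: f_def g_def algebra_simps eval_nat_numeral)
  have g_decreasing: "g y < g x" if "0 < x" "x < y" for x y
  proof -
    have *: "1 / y ^ n < 1 / x ^ n" if "0 < n" for n
      using \<open>0 < x\<close> \<open>x < y\<close> that
      by (intro divide_strict_left_mono power_strict_mono mult_pos_pos zero_less_power) auto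
    show ?thesis unfolding g_def using *[of 2] *[of 3] *[of 4] *[of 5] *[of 6] by simp
  qed
  have "\<exists>x\<ge>1. x \<le> 1.65 \<and> f x = 0"
    by (rule IVT') (auto simp: f_def eval_nat_numeral intro!: continuous_intros)
  then obtain x where x: "1 \<le> x" "x \<le> 1.65" "f x = 0" by blast
  have "f 1 \<noteq> 0" "f 1.65 \<noteq> 0" by (simp_all add: f_def eval_nat_numeral)
  then have "x \<noteq> 1" "x \<noteq> 1.65" using x(3) by metis+
  have "q_aleph0 = x" unfolding q_aleph0_def
  proof (rule the_equality)
    show "1 < x \<and> x < 2 \<and> x ^ 6 = x ^ 4 + x ^ 3 + 2 * x ^ 2 + x + 1"
      using x \<open>x \<noteq> 1\<close> by (simp add: f_def)
    fix z :: real assume z: "1 < z \<and> z < 2 \<and> z ^ 6 = z ^ 4 + z ^ 3 + 2 * z ^ 2 + z + 1"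
    then have "f z = 0" by (simp add: f_def)
    then have "g z = g x" using fg[of z] fg[of x] x z by auto
    then show "z = x" using g_decreasing[of x z] g_decreasing[of z x] x z
      by (cases x z rule: linorder_cases) auto
  qed
  then show "1 < q_aleph0" "q_aleph0 < 1.65"
    using x \<open>x \<noteq> 1\<close> \<open>x \<noteq> 1.65\<close> by simp_all
qed

theorem uniform_dim_bound_small_base:
  assumes q: "1 < q" "q < 1.65" "q \<noteq> golden_ratio"
  shows "\<exists>s::real. s > 0 \<and> (\<forall>y. uncountable (slice q y) \<longrightarrow> ereal s \<le> hausdorff_dim (slice q y))"
proof -
  consider "q\<^sup>2 < q + 1" | "q + 1 < q\<^sup>2" using golden_ratio_iff[OF q(1)] q(3) by linarith
  then show ?thesis
  proof cases
    case 1
    show ?thesis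
    proof (rule uniform_dim_bound_of_branching[OF q(1) _ two_branches_reach])
      show "reaches_core q (2 - q)" by (rule branching_below_golden_ratio[OF q(1) 1])
      fix y assume y: "y \<in> {1 - 1 / q<..<1 / q}"
      then have "0 < q * y" "q * y < 1" using q by (auto simp: field_simps)
      then have "reaches_core q (q * y)" using branching_below_golden_ratio(2)[OF q(1) 1] by simp
      then show "reaches_core q (q * y) \<or> reaches_core q (q * y - (q - 1))"
        "reaches_core q (q * y) \<or> reaches_core q ((1 - q * y) / (2 - q))" by simp_all
    qed (use q in auto)
  next
    case 2
    interpret above_golden_ratio q by unfold_locales (use q 2 in auto)
    show ?thesis
      by (rule uniform_dim_bound_of_branching[OF q(1) _ two_branches_reach])
        (use q outer_branches_reach adjacent_branches_reach endpoint_reaches_core in auto)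
  qed
qed

section \<open>Sequences dominated by the Thue-Morse sequence\<close>

fun thue_morse :: "nat \<Rightarrow> bool" where
  "thue_morse n = (if n = 0 then False else thue_morse (n div 2) \<noteq> odd n)"

declare thue_morse.simps [simp del]

text \<open>Dropping the initial \<open>0\<close> of the Thue-Morse sequence makes it start with its largest tail.\<close>

definition tau :: "nat \<Rightarrow> bool" where
  "tau i = thue_morse (Suc i)"

definition first_diff :: "nat \<Rightarrow> (nat \<Rightarrow> bool) \<Rightarrow> (nat \<Rightarrow> bool) \<Rightarrow> bool" where
  "first_diff k s c \<longleftrightarrow> (\<forall>i<k. s i = c i) \<and> \<not> s k \<and> c k"

definition lex_less :: "(nat \<Rightarrow> bool) \<Rightarrow> (nat \<Rightarrow> bool) \<Rightarrow> bool" where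
  "lex_less s c \<longleftrightarrow> (\<exists>k. first_diff k s c)"

text \<open>Up to its first digit, \<open>c\<close> is the image of \<open>d\<close> under the substitution \<open>1 \<mapsto> 10\<close>,
  \<open>0 \<mapsto> 01\<close>. The first digit is left open: it is the second half of a block that started earlier.\<close>

definition weaves :: "(nat \<Rightarrow> bool) \<Rightarrow> (nat \<Rightarrow> bool) \<Rightarrow> bool" where
  "weaves c d \<longleftrightarrow> (\<forall>i. c (2 * i + 1) = d i \<and> c (2 * i + 2) = (\<not> d i))"

lemma weaves_shift: "weaves c d \<Longrightarrow> weaves (\<lambda>i. c (2 * n + i)) (\<lambda>i. d (n + i))"
  unfolding weaves_def by (metis (no_types, lifting) add.assoc distrib_left)

lemma weaves_not: "weaves c d \<Longrightarrow> weaves (\<lambda>i. \<not> c i) (\<lambda>i. \<not> d i)"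
  unfolding weaves_def by blast

lemma weaves_tau: "weaves tau tau"
  unfolding weaves_def
proof (intro allI conjI)
  fix i
  have "thue_morse (Suc (2 * i + 1)) = thue_morse (Suc i)"
    by (subst thue_morse.simps) simp
  then show "tau (2 * i + 1) = tau i" by (simp add: tau_def)
  have "thue_morse (Suc (2 * i + 2)) = (\<not> thue_morse (Suc i))"
    by (subst thue_morse.simps) simp
  then show "tau (2 * i + 2) = (\<not> tau i)" by (simp add: tau_def)
qed

lemma tau_0: "tau 0"
  unfolding tau_def by (subst thue_morse.simps) (simp add: thue_morse.simps[of 0])

lemma tau_odd: "tau (2 * i + 1) = tau i" and tau_even: "tau (2 * i + 2) = (\<not> tau i)"
  using weaves_tau unfolding weaves_def by blast+

lemma tau_values: "tau 0" "tau 1" "\<not> tau 2" "tau 3" "\<not> tau 4" "\<not> tau 5"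
  using tau_0 tau_odd[of 0] tau_even[of 0] tau_odd[of 1] tau_even[of 1] tau_odd[of 2]
  by (simp_all add: eval_nat_numeral)

text \<open>The substitution preserves the lexicographic order: a first difference sits in the first
  half of a block.\<close>

lemma first_diff_weaves:
  assumes s: "weaves s d" and c: "weaves c f" and start: "s 0 = c 0"
  shows "first_diff k s c \<longleftrightarrow> (\<exists>l. k = 2 * l + 1 \<and> first_diff l d f)"
proof
  have odd: "s (2 * i + 1) = d i" "c (2 * i + 1) = f i" for i
    using s c unfolding weaves_def by blast+
  have even: "s (2 * i + 2) = (\<not> d i)" "c (2 * i + 2) = (\<not> f i)" for i
    using s c unfolding weaves_def by blast+
  {
    assume fd: "first_diff k s c"
    have "k \<noteq> 0"
    proof
      assume "k = 0" then show False using fd start by (simp add: first_diff_def)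
    qed
    have "odd k"
    proof (rule ccontr)
      assume "\<not> odd k"
      then obtain m where "k = 2 * m" by (auto elim: evenE)
      then obtain l where l: "k = 2 * l + 2" using \<open>k \<noteq> 0\<close> by (cases m) auto
      then have "s (2 * l + 1) = c (2 * l + 1)" using fd by (simp add: first_diff_def)
      then have "s k = c k" by (simp only: l odd even)
      then show False using fd by (simp add: first_diff_def)
    qed
    then obtain l where l: "k = 2 * l + 1" by (auto elim: oddE)
    have "d i = f i" if "i < l" for i
    proof -
      have "s (2 * i + 1) = c (2 * i + 1)" using fd that by (simp add: first_diff_def l)
      then show ?thesis by (simp only: odd)
    qed
    moreover have "\<not> d l" "f l" using fd unfolding first_diff_def l odd by blast+
    ultimately show "\<exists>l. k = 2 * l + 1 \<and> first_diff l d f" using l by (auto simp: first_diff_def)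
  }
  {
    assume "\<exists>l. k = 2 * l + 1 \<and> first_diff l d f"
    then obtain l where l: "k = 2 * l + 1" "first_diff l d f" by blast
    have "s i = c i" if "i < k" for i
    proof -
      consider "i = 0" | m where "i = 2 * m + 1" | m where "i = 2 * m + 2"
      proof (cases "odd i")
        case True then show ?thesis using that(2) by (auto elim: oddE)
      next
        case False
        then obtain m where "i = 2 * m" by (auto elim: evenE)
        then show ?thesis using that(1) that(3)[of "m - 1"] by (cases m) auto
      qed
      then show ?thesis
      proof cases
        case 1 then show ?thesis using start by simp
      next
        case (2 m)
        then have "d m = f m" using l that by (simp add: first_diff_def)
        then show ?thesis by (simp only: 2 odd)
      next
        case (3 m)
        then have "d m = f m" using l that by (simp add: first_diff_def)
        then show ?thesis by (simp only: 3 even)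
      qed
    qed
    then show "first_diff k s c" using l(2) by (simp only: first_diff_def l odd) simp
  }
qed

text \<open>A tail of \<open>tau\<close> that starts at an even position and with the digit \<open>1\<close> is again of the form
  \<open>1\<close> followed by the substituted image of an earlier tail, so induction applies. In all other
  cases one of the first two digits decides.\<close>

lemma tau_maximal:
  assumes "0 < n"
  shows "lex_less (\<lambda>i. tau (n + i)) tau \<and> lex_less (\<lambda>i. \<not> tau (n + i)) tau"
  using assms
proof (induction n rule: less_induct)
  case (less n)
  have at_0: "lex_less s tau" if "\<not> s 0" for s
    unfolding lex_less_def first_diff_def using that tau_values by (intro exI[of _ 0]) simp
  have at_1: "lex_less s tau" if "s 0" "\<not> s 1" for s
    unfolding lex_less_def first_diff_def using that tau_values by (intro exI[of _ 1]) simp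
  show ?case
  proof (cases "even n")
    case True
    then obtain m where m: "n = 2 * m" by (auto elim: evenE)
    then have IH: "lex_less (\<lambda>i. tau (m + i)) tau" "lex_less (\<lambda>i. \<not> tau (m + i)) tau"
      using less by auto
    have w: "weaves (\<lambda>i. tau (n + i)) (\<lambda>i. tau (m + i))"
      unfolding m by (rule weaves_shift[OF weaves_tau])
    have "lex_less (\<lambda>i. tau (n + i)) tau"
    proof (cases "tau n")
      case True
      then show ?thesis
        using IH(1) first_diff_weaves[OF w weaves_tau] tau_0 unfolding lex_less_def by auto
    qed (use at_0 in simp)
    moreover have "lex_less (\<lambda>i. \<not> tau (n + i)) tau"
    proof (cases "tau n")
      case False
      then show ?thesis
        using IH(2) first_diff_weaves[OF weaves_not[OF w] weaves_tau] tau_0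
        unfolding lex_less_def by auto
    qed (use at_0 in simp)
    ultimately show ?thesis ..
  next
    case False
    then obtain m where m: "n = 2 * m + 1" by (auto elim: oddE)
    then have "tau n = tau m" "tau (n + 1) = (\<not> tau m)"
      using tau_odd[of m] tau_even[of m] by simp_all
    then show ?thesis
      using at_0[of "\<lambda>i. tau (n + i)"] at_1[of "\<lambda>i. tau (n + i)"]
        at_0[of "\<lambda>i. \<not> tau (n + i)"] at_1[of "\<lambda>i. \<not> tau (n + i)"]
      by (cases "tau m") auto
  qed
qed

text \<open>All tails of \<open>c\<close> and of its complement are smaller than \<open>tau\<close>, with the first difference
  before position \<open>M\<close>. The bound \<open>M\<close> measures the distance from the Komornik-Loreti constant and
  drives the renormalisation.\<close>

definition admissible :: "nat \<Rightarrow> (nat \<Rightarrow> bool) \<Rightarrow> bool" where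
  "admissible M c \<longleftrightarrow> (\<forall>n. (\<exists>k<M. first_diff k (\<lambda>i. c (n + i)) tau) \<and>
     (\<exists>k<M. first_diff k (\<lambda>i. \<not> c (n + i)) tau))"

lemma admissible_shift: "admissible M c \<Longrightarrow> admissible M (\<lambda>i. c (n + i))"
  unfolding admissible_def by (simp flip: add.assoc)

lemma admissible_not: "admissible M c \<Longrightarrow> admissible M (\<lambda>i. \<not> c i)"
  unfolding admissible_def by simp

lemma first_diff_signed:
  assumes "admissible M c"
  shows "\<exists>k<M. first_diff k (\<lambda>i. c (n + i) = b) tau"
  using assms unfolding admissible_def by (cases b) simp_all

lemma first_diff_contra:
  assumes "first_diff k s c" "\<And>i. i < j \<Longrightarrow> s i = c i" "s j" "\<not> c j"
  shows False
  using assms unfolding first_diff_def by (metis linorder_less_linear)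

text \<open>The forbidden words, here and in the next two lemmas, are those that agree with
  \<open>tau = 110100...\<close> up to a position where they have a \<open>1\<close> and \<open>tau\<close> has a \<open>0\<close>. The sign \<open>b\<close>
  covers the complementary words at the same time.\<close>

lemma forbidden_111:
  assumes "admissible M c" "c n = b" "c (n + 1) = b"
  shows "c (n + 2) = (\<not> b)"
proof (rule ccontr)
  assume not: "\<not> ?thesis"
  obtain k where "first_diff k (\<lambda>i. c (n + i) = b) tau" using first_diff_signed[OF assms(1)] by blast
  then show False
  proof (rule first_diff_contra[where j = 2])
    show "(c (n + i) = b) = tau i" if "i < 2" for i
      using that assms tau_values by (cases i) (auto simp: less_Suc_eq numeral_2_eq_2)
  qed (use not tau_values in auto)
qed

lemma forbidden_11011:
  assumes "admissible M c" "c n = b" "c (n + 1) = b" "c (n + 2) = (\<not> b)" "c (n + 3) = b"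
  shows "c (n + 4) = (\<not> b)"
proof (rule ccontr)
  assume not: "\<not> ?thesis"
  obtain k where "first_diff k (\<lambda>i. c (n + i) = b) tau" using first_diff_signed[OF assms(1)] by blast
  then show False
  proof (rule first_diff_contra[where j = 4])
    fix i :: nat assume "i < 4"
    then consider "i = 0" | "i = 1" | "i = 2" | "i = 3" by linarith
    then show "(c (n + i) = b) = tau i" using assms tau_values by cases auto
  qed (use not tau_values in auto)
qed

lemma forbidden_110101:
  assumes "admissible M c" "c n = b" "c (n + 1) = b" "c (n + 2) = (\<not> b)" "c (n + 3) = b"
    "c (n + 4) = (\<not> b)"
  shows "c (n + 5) = (\<not> b)"
proof (rule ccontr)
  assume not: "\<not> ?thesis"
  obtain k where "first_diff k (\<lambda>i. c (n + i) = b) tau" using first_diff_signed[OF assms(1)] by blast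
  then show False
  proof (rule first_diff_contra[where j = 5])
    fix i :: nat assume "i < 5"
    then consider "i = 0" | "i = 1" | "i = 2" | "i = 3" | "i = 4" by linarith
    then show "(c (n + i) = b) = tau i" using assms tau_values by cases auto
  qed (use not tau_values in auto)
qed

text \<open>If two consecutive positions inside a block carried equal digits, look at the last equal
  pair across a block boundary before them. Between the two pairs the sequence alternates, and the
  two pairs have opposite parity, so a word \<open>111\<close>, \<open>11011\<close> or \<open>110101\<close> (or its complement)
  occurs, and all of these are forbidden.\<close>

lemma admissible_weaves:
  assumes adm: "admissible M c" and start: "c 0 = c 1"
  shows "weaves c (\<lambda>i. c (2 * i + 1))"
proof -
  have "c (2 * i + 2) = (\<not> c (2 * i + 1))" for i
  proof (induction i rule: less_induct)
    case (less i)
    define b where "b = c (2 * i + 1)"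
    define S where "S = {j. j \<le> i \<and> c (2 * j) = c (2 * j + 1)}"
    define j where "j = Max S"
    have "finite S" "0 \<in> S" using start by (auto simp: S_def)
    then have "j \<in> S" unfolding j_def by (intro Max_in) auto
    then have j: "j \<le> i" "c (2 * j) = c (2 * j + 1)" by (auto simp: S_def)
    have after: "c (2 * l) \<noteq> c (2 * l + 1)" if "j < l" "l \<le> i" for l
      using that Max_ge[OF \<open>finite S\<close>, of l] unfolding j_def[symmetric] by (force simp: S_def)
    have const: "c (2 * (j + l) + 1) = c (2 * j + 1)" if "j + l \<le> i" for l
      using that
    proof (induction l)
      case (Suc l)
      have "c (2 * (j + l) + 2) = (\<not> c (2 * (j + l) + 1))" using less.IH[of "j + l"] Suc.prems by simp
      moreover have "c (2 * (j + l) + 2) \<noteq> c (2 * (j + l) + 3)"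
        using after[of "j + Suc l"] Suc.prems by (simp add: eval_nat_numeral)
      ultimately have "c (2 * (j + l) + 3) = c (2 * (j + l) + 1)" by blast
      then show ?case using Suc by (simp add: eval_nat_numeral)
    qed simp
    have b: "b = c (2 * j + 1)" using const[of "i - j"] j by (simp add: b_def)
    consider "i = j" | "i = j + 1" | "j + 2 \<le> i" using j by linarith
    then have "c (2 * i + 2) = (\<not> b)"
    proof cases
      case 1
      then show ?thesis using forbidden_111[OF adm, of "2 * j" b] j b by simp
    next
      case 2
      have "c (2 * j + 2) = (\<not> b)" using less.IH[of j] b 2 by simp
      moreover have "c (2 * j + 3) = b" using const[of 1] 2 b by (simp add: eval_nat_numeral)
      ultimately have "c (2 * j + 4) = (\<not> b)"
        using forbidden_11011[OF adm, of "2 * j" b] j b by simp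
      then show ?thesis by (simp add: 2 eval_nat_numeral)
    next
      case 3
      have "c (2 * j + 2) = (\<not> b)" using less.IH[of j] b 3 by simp
      moreover have "c (2 * j + 3) = b" using const[of 1] 3 b by (simp add: eval_nat_numeral)
      moreover have "c (2 * j + 4) = (\<not> b)"
        using less.IH[of "j + 1"] 3 calculation(2) by (simp add: eval_nat_numeral)
      moreover have "c (2 * j + 5) = b" using const[of 2] 3 b by (simp add: eval_nat_numeral)
      ultimately have False using forbidden_110101[OF adm, of "2 * j" b] j b by simp
      then show ?thesis ..
    qed
    then show ?case by (simp add: b_def)
  qed
  then show ?thesis unfolding weaves_def by blast
qed

lemma weave_no_three_equal:
  assumes adm: "admissible M c" and w: "weaves c d" and start: "c 0 = c 1"
  shows "\<not> (d m = b \<and> d (m + 1) = b \<and> d (m + 2) = b)"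
proof (induction m)
  have odd: "c (2 * i + 1) = d i" and even: "c (2 * i + 2) = (\<not> d i)" for i
    using w unfolding weaves_def by blast+
  have key: "\<not> (d m = b \<and> d (m + 1) = b \<and> d (m + 2) = b)" if "c (2 * m) = b" for m
  proof
    assume "d m = b \<and> d (m + 1) = b \<and> d (m + 2) = b"
    then have "c (2 * m + 1) = b" "c (2 * m + 2) = (\<not> b)" "c (2 * m + 3) = b"
      "c (2 * m + 4) = (\<not> b)" "c (2 * m + 5) = b"
      using odd[of m] even[of m] odd[of "m + 1"] even[of "m + 1"] odd[of "m + 2"]
      by (simp_all add: eval_nat_numeral)
    then show False using forbidden_110101[OF adm, of "2 * m" b] that by simp
  qed
  {
    case 0
    show ?case using key[of 0] start odd[of 0] by auto
  next
    case (Suc m)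
    show ?case
    proof (cases "c (2 * Suc m) = b")
      case True then show ?thesis by (rule key)
    next
      case False
      then have "d m = b" using even[of m] by auto
      then show ?thesis using Suc by auto
    qed
  }
qed

text \<open>If the digit before the blocks is \<open>1\<close>, the comparison of \<open>c\<close> with \<open>tau\<close> descends to \<open>d\<close>
  directly and halves the position of the first difference. If it is \<open>0\<close>, the previous block is
  \<open>10\<close>; as there are no three equal blocks in a row, \<open>d\<close> continues with \<open>0\<close> or \<open>10\<close>, which is
  smaller than \<open>11...\<close>.\<close>

lemma desubstituted_tail_less:
  assumes adm: "admissible M c" and w: "weaves c d" and start: "c 0 = c 1" and M: "4 \<le> M"
  shows "\<exists>k<M div 2. first_diff k (\<lambda>i. d (n + i)) tau"
proof (cases "d n")
  case False
  then show ?thesis using M tau_0 by (intro exI[of _ 0]) (simp add: first_diff_def)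
next
  case dn: True
  show ?thesis
  proof (cases "c (2 * n)")
    case True
    obtain k where k: "k < M" "first_diff k (\<lambda>i. c (2 * n + i)) tau"
      using adm unfolding admissible_def by blast
    then obtain l where "k = 2 * l + 1" "first_diff l (\<lambda>i. d (n + i)) tau"
      using first_diff_weaves[OF weaves_shift[OF w] weaves_tau] True tau_0 by auto
    then show ?thesis using k(1) by (intro exI[of _ l]) auto
  next
    case False
    have "n \<noteq> 0"
    proof
      assume "n = 0"
      then show False using False dn start w unfolding weaves_def by (metis add_0 mult_0_right)
    qed
    then obtain m where m: "n = Suc m" by (cases n) auto
    have "c (2 * m + 2) = (\<not> d m)" using w unfolding weaves_def by blast
    then have "d m" using False by (simp add: m)
    then have "\<not> d (n + 1)" using weave_no_three_equal[OF adm w start, of m True] dn by (simp add: m)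
    then show ?thesis using dn M tau_values
      by (intro exI[of _ 1]) (simp add: first_diff_def)
  qed
qed

lemma admissible_desubstitute:
  assumes adm: "admissible M c" and w: "weaves c d" and start: "c 0 = c 1" and M: "4 \<le> M"
  shows "admissible (M div 2) d"
  unfolding admissible_def
  using desubstituted_tail_less[OF assms]
    desubstituted_tail_less[OF admissible_not[OF adm] weaves_not[OF w] _ M] start
  by simp

text \<open>A pair of equal digits agrees with \<open>tau = 1101...\<close> in the first two digits, and at
  position \<open>2\<close> the digit \<open>0\<close> of \<open>tau\<close> cannot be the larger one.\<close>

lemma admissible_double_digit:
  assumes "admissible M c" "c n = c (n + 1)"
  shows "4 \<le> M"
proof (rule ccontr)
  assume "\<not> 4 \<le> M"
  obtain k where "k < M" and fd: "first_diff k (\<lambda>i. c (n + i) = c n) tau"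
    using first_diff_signed[OF assms(1)] by blast
  then consider "k = 0" | "k = 1" | "k = 2" using \<open>\<not> 4 \<le> M\<close> by linarith
  then show False
    by cases (use fd assms(2) tau_values in \<open>auto simp: first_diff_def\<close>)
qed

definition eventually_periodic :: "(nat \<Rightarrow> 'a) \<Rightarrow> bool" where
  "eventually_periodic c \<longleftrightarrow> (\<exists>m. \<exists>p>0. \<forall>i\<ge>m. c (i + p) = c i)"

lemma eventually_periodic_unshift:
  assumes "eventually_periodic (\<lambda>i. c (n + i))"
  shows "eventually_periodic c"
proof -
  obtain m p where p: "0 < p" "\<And>i. m \<le> i \<Longrightarrow> c (n + (i + p)) = c (n + i)"
    using assms unfolding eventually_periodic_def by blast
  have "c (i + p) = c i" if "n + m \<le> i" for i
    using p(2)[of "i - n"] that by (simp add: le_diff_conv2)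
  then show ?thesis unfolding eventually_periodic_def using p(1) by blast
qed

lemma eventually_periodic_weaves:
  assumes w: "weaves c d" and d: "eventually_periodic d"
  shows "eventually_periodic c"
proof -
  obtain m p where p: "0 < p" "\<And>i. m \<le> i \<Longrightarrow> d (i + p) = d i"
    using d unfolding eventually_periodic_def by blast
  have odd: "c (2 * i + 1) = d i" and even: "c (2 * i + 2) = (\<not> d i)" for i
    using w unfolding weaves_def by blast+
  have "c (i + 2 * p) = c i" if i: "2 * m + 1 \<le> i" for i
  proof (cases "even i")
    case True
    then obtain l where l: "i = 2 * l + 2" using i
      by (metis Suc_1 add_eq_if add_leE evenE mult_0_right mult_Suc_right not_one_le_zero add.commute)
    then have "d (l + p) = d l" using p(2) i by simp
    moreover have "i + 2 * p = 2 * (l + p) + 2" using l by simp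
    ultimately show ?thesis by (simp only: even l)
  next
    case False
    then obtain l where l: "i = 2 * l + 1" by (auto elim: oddE)
    then have "d (l + p) = d l" using p(2) i by simp
    moreover have "i + 2 * p = 2 * (l + p) + 1" using l by simp
    ultimately show ?thesis by (simp only: odd l)
  qed
  then show ?thesis unfolding eventually_periodic_def using p(1)
    by (intro exI[of _ "2 * m + 1"] exI[of _ "2 * p"]) simp
qed

text \<open>Either \<open>c\<close> alternates, or its tail from a pair of equal digits on is a weave of a sequence
  that is admissible with half the bound.\<close>

theorem admissible_eventually_periodic:
  "admissible M c \<Longrightarrow> eventually_periodic c"
proof (induction M arbitrary: c rule: less_induct)
  case (less M)
  show ?case
  proof (cases "\<exists>n. c n = c (n + 1)")
    case False
    then have "c (n + 2) = c n" for n
      by (metis Suc_1 Suc_eq_plus1 add_Suc_right)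
    then show ?thesis unfolding eventually_periodic_def by (intro exI[of _ 0] exI[of _ 2]) simp
  next
    case True
    then obtain n where n: "c n = c (n + 1)" by blast
    define e where "e = (\<lambda>i. c (n + i))"
    have e: "admissible M e" unfolding e_def by (rule admissible_shift[OF less.prems])
    have start: "e 0 = e 1" using n by (simp add: e_def)
    have M: "4 \<le> M" by (rule admissible_double_digit[OF less.prems n])
    have w: "weaves e (\<lambda>i. e (2 * i + 1))" by (rule admissible_weaves[OF e start])
    have "eventually_periodic (\<lambda>i. e (2 * i + 1))"
      using M by (intro less.IH[OF _ admissible_desubstitute[OF e w start M]]) simp
    then have "eventually_periodic e" by (rule eventually_periodic_weaves[OF w])
    then show ?thesis unfolding e_def by (rule eventually_periodic_unshift)
  qed
qed

text \<open>This lexicographic property characterises the unique expansions of \<open>1\<close>.\<close>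

definition dominating :: "(nat \<Rightarrow> bool) \<Rightarrow> bool" where
  "dominating c \<longleftrightarrow>
     (\<forall>n>0. lex_less (\<lambda>i. c (n + i)) c \<and> lex_less (\<lambda>i. \<not> c (n + i)) c)"

lemma lex_less_second_digit:
  assumes "lex_less s c" "s 0" "s 1"
  shows "c 1"
proof -
  obtain k where k: "first_diff k s c" using assms(1) unfolding lex_less_def by blast
  then have "k \<noteq> 0" using assms(2) by (cases k) (auto simp: first_diff_def)
  moreover have "k \<noteq> 1" using k assms(3) by (auto simp: first_diff_def)
  ultimately show ?thesis using k assms(3) by (simp add: first_diff_def)
qed

text \<open>Domination is inherited by the sequence of blocks. The argument for the tails of \<open>d\<close> and for
  their complements is the same, so \<open>(x, X)\<close> stands for \<open>(d, c)\<close> or for the complementary pair.\<close>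

lemma dominating_desubstitute:
  assumes adm: "admissible M c" and w: "weaves c d" and start: "c 0" "c 1"
    and x: "x = d \<and> X = c \<or> x = (\<lambda>i. \<not> d i) \<and> X = (\<lambda>i. \<not> c i)"
    and less: "\<And>n. 0 < n \<Longrightarrow> lex_less (\<lambda>i. X (n + i)) c" and "0 < n"
  shows "lex_less (\<lambda>i. x (n + i)) d"
proof -
  have d0: "d 0" using w start unfolding weaves_def by (metis add_0 mult_0_right)
  have wX: "weaves X x" using x w weaves_not by auto
  have three: "\<not> (x m \<and> x (m + 1) \<and> x (m + 2))" for m
    using x weave_no_three_equal[OF adm w, of m True] weave_no_three_equal[OF adm w, of m False] start
    by auto
  have prev: "x m" if "\<not> X (2 * Suc m)" for m
    using wX that unfolding weaves_def by (metis add.commute mult_Suc_right)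
  have direct: "lex_less (\<lambda>i. x (m + i)) d" if m: "0 < m" "X (2 * m)" for m
  proof -
    have "lex_less (\<lambda>i. X (2 * m + i)) c" using less m by simp
    then show ?thesis
      using first_diff_weaves[OF weaves_shift[OF wX, of m] w] m start unfolding lex_less_def by auto
  qed
  obtain m where m: "n = Suc m" using \<open>0 < n\<close> by (cases n) auto
  show ?thesis
  proof (cases "X (2 * n)")
    case True
    then show ?thesis using direct[OF \<open>0 < n\<close>] by simp
  next
    case False
    then have xm: "x m" using prev m by simp
    show ?thesis
    proof (cases "x n")
      case False
      then show ?thesis using d0 unfolding lex_less_def first_diff_def
        by (intro exI[of _ 0]) simp
    next
      case xn: True
      then have xn1: "\<not> x (n + 1)" using three[of m] xm m by auto
      \<comment> \<open>otherwise \<open>d = 10...\<close> would be exceeded by the tail \<open>11...\<close> of \<open>x\<close> starting at \<open>m\<close>\<close>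
      have "d 1"
      proof (cases m)
        case 0
        then show ?thesis using x xm xn m d0 by auto
      next
        case (Suc l)
        have "X (2 * m)" using prev[of l] three[of l] xm xn m Suc by auto
        then have "lex_less (\<lambda>i. x (m + i)) d" using direct[of m] Suc by blast
        then show ?thesis by (rule lex_less_second_digit) (use xm xn m in auto)
      qed
      then show ?thesis using xn xn1 d0 unfolding lex_less_def first_diff_def
        by (intro exI[of _ 1]) simp
    qed
  qed
qed

text \<open>A dominating sequence starts with \<open>11\<close>, since otherwise it would alternate and coincide with
  its second tail. So it can be desubstituted, and the bound \<open>M\<close> is halved forever.\<close>

theorem dominating_not_admissible:
  "dominating c \<Longrightarrow> \<not> admissible M c"
proof (induction M arbitrary: c rule: less_induct)
  case (less M)
  show ?case
  proof
    assume adm: "admissible M c"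
    have dom: "lex_less (\<lambda>i. c (n + i)) c" "lex_less (\<lambda>i. \<not> c (n + i)) c" if "0 < n" for n
      using less.prems that unfolding dominating_def by blast+
    have irrefl: "\<not> lex_less c c" unfolding lex_less_def first_diff_def by blast
    have c0: "c 0"
    proof (rule ccontr)
      assume "\<not> c 0"
      then have "\<not> s 0" if "lex_less s c" for s
        using that unfolding lex_less_def first_diff_def by (metis gr0I)
      from this[OF dom(1)[of 1]] this[OF dom(2)[of 1]] show False by simp
    qed
    have "\<exists>n. c n = c (n + 1)"
    proof (rule ccontr)
      assume "\<not> ?thesis"
      then have "c (2 + n) = c n" for n by (metis Suc_1 Suc_eq_plus1 add.commute add_Suc_right)
      then show False using dom(1)[of 2] irrefl by simp
    qed
    then obtain n where n: "c n = c (n + 1)" by blast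
    have c1: "c 1"
    proof (cases "n = 0")
      case True then show ?thesis using n c0 by simp
    next
      case False
      then show ?thesis
        using n lex_less_second_digit[OF dom(1)[of n]] lex_less_second_digit[OF dom(2)[of n]] by (cases "c n") auto
    qed
    have start: "c 0 = c 1" using c0 c1 by simp
    define d where "d = (\<lambda>i. c (2 * i + 1))"
    have w: "weaves c d" unfolding d_def by (rule admissible_weaves[OF adm start])
    have M: "4 \<le> M" by (rule admissible_double_digit[OF adm n])
    have "dominating d" unfolding dominating_def
    proof (intro allI impI conjI)
      fix n :: nat assume "0 < n"
      show "lex_less (\<lambda>i. d (n + i)) d"
        by (rule dominating_desubstitute[OF adm w c0 c1 _ _ \<open>0 < n\<close>, where X = c]) (use dom in auto)
      show "lex_less (\<lambda>i. \<not> d (n + i)) d"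
        by (rule dominating_desubstitute[OF adm w c0 c1 _ _ \<open>0 < n\<close>,
              where X = "\<lambda>i. \<not> c i" and x = "\<lambda>i. \<not> d i"]) (use dom in auto)
    qed
    moreover have "admissible (M div 2) d" by (rule admissible_desubstitute[OF adm w start M])
    ultimately show False using less.IH[of "M div 2" d] M by simp
  qed
qed

section \<open>The Komornik-Loreti constant\<close>

abbreviation tail :: "nat \<Rightarrow> (nat \<Rightarrow> 'a) \<Rightarrow> nat \<Rightarrow> 'a" where
  "tail n c \<equiv> (\<lambda>i. c (n + i))"

lemma beta_val_tail_Suc:
  assumes "1 < q"
  shows "beta_val q (tail (Suc n) c) = q * beta_val q (tail n c) - of_bool (c n)"
  using beta_val_Suc[OF assms, of "tail n c"] assms by simp

lemma beta_val_pos: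
  assumes "1 < q" "c i"
  shows "0 < beta_val q c"
  unfolding beta_val_def
  by (rule suminf_pos2[OF beta_summable[OF assms(1)], of _ i]) (use assms in auto)

lemma first_diff_beta_val:
  assumes q: "1 < q" and fd: "first_diff k s c"
  shows "beta_val q c - beta_val q s =
    (1 + beta_val q (tail (Suc k) c) - beta_val q (tail (Suc k) s)) / q ^ Suc k"
proof -
  have "(\<Sum>i<k. of_bool (s i) / q ^ Suc i) = (\<Sum>i<k. of_bool (c i) / q ^ Suc i :: real)"
    using fd by (intro sum.cong) (auto simp: first_diff_def)
  then show ?thesis
    using beta_val_split[OF q, of c "Suc k"] beta_val_split[OF q, of s "Suc k"] fd
    by (simp add: first_diff_def diff_divide_distrib add_divide_distrib)
qed

lemma sequences_differ:
  assumes "s \<noteq> (c :: nat \<Rightarrow> bool)"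
  obtains k where "first_diff k s c \<or> first_diff k c s"
proof -
  define k where "k = (LEAST k. s k \<noteq> c k)"
  have "s k \<noteq> c k" unfolding k_def by (rule LeastI_ex) (use assms in auto)
  moreover have "s i = c i" if "i < k" for i
    using that not_less_Least unfolding k_def by blast
  ultimately have "first_diff k s c \<or> first_diff k c s" by (auto simp: first_diff_def)
  then show ?thesis using that by blast
qed

text \<open>Values and lexicographic order agree as long as no proper tail of \<open>c\<close> reaches the value \<open>1\<close>,
  which is what a digit at the first difference is worth.\<close>

lemma lex_less_of_beta_val_less:
  assumes q: "1 < q" and tails: "\<And>n. beta_val q (tail (Suc n) c) < 1"
    and less: "beta_val q s < beta_val q c"
  shows "lex_less s c"
proof -
  have "s \<noteq> c" using less by auto
  then obtain k where "first_diff k s c \<or> first_diff k c s" by (rule sequences_differ)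
  moreover have False if "first_diff k c s"
  proof -
    have "beta_val q s - beta_val q c =
        (1 + beta_val q (tail (Suc k) s) - beta_val q (tail (Suc k) c)) / q ^ Suc k"
      by (rule first_diff_beta_val[OF q that])
    moreover have "0 < 1 + beta_val q (tail (Suc k) s) - beta_val q (tail (Suc k) c)"
      using tails[of k] beta_val_nonneg[OF q, of "tail (Suc k) s"] by linarith
    ultimately have "0 < beta_val q s - beta_val q c" using q by simp
    then show False using less by simp
  qed
  ultimately show ?thesis unfolding lex_less_def by blast
qed

text \<open>Let \<open>V\<close> be the supremum of the values of all tails of \<open>s\<close>. Comparing a tail with the
  expansion \<open>c\<close> of \<open>1\<close> at their first difference bounds its value by \<open>1 + (V - 1) / q\<close>, unless
  \<open>V \<le> 1\<close> already; hence \<open>V \<le> 1\<close>. The same comparison then gives the strict inequality because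
  the tails of \<open>c\<close> have positive value.\<close>

lemma beta_val_less_1_of_lex_less:
  assumes q: "1 < q" and c: "beta_val q c = 1" "\<And>n. \<exists>i. c (n + i)"
    and less: "\<And>n. lex_less (tail n s) c"
  shows "beta_val q (tail n s) < 1"
proof -
  define v where "v n = beta_val q (tail n s)" for n
  have v: "\<exists>k. v n - 1 = (v (n + Suc k) - 1 - beta_val q (tail (Suc k) c)) / q ^ Suc k" for n
  proof -
    obtain k where "first_diff k (tail n s) c" using less unfolding lex_less_def by blast
    from first_diff_beta_val[OF q this]
    have "v n - 1 = (v (n + Suc k) - 1 - beta_val q (tail (Suc k) c)) / q ^ Suc k"
      unfolding v_def c(1) using q by (simp add: add.assoc field_simps)
    then show ?thesis by blast
  qed
  have c_pos: "0 < beta_val q (tail k c)" for k using beta_val_pos[OF q] c(2)[of k] by auto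
  define V where "V = Sup (range v)"
  have bdd: "bdd_above (range v)" unfolding v_def using beta_val_le[OF q] by (intro bdd_aboveI2) auto
  have le_V: "v n \<le> V" for n unfolding V_def using bdd by (intro cSup_upper) auto
  have "V \<le> 1"
  proof (rule ccontr)
    assume "\<not> V \<le> 1"
    have "v n \<le> 1 + (V - 1) / q" for n
    proof -
      obtain k where k: "v n - 1 = (v (n + Suc k) - 1 - beta_val q (tail (Suc k) c)) / q ^ Suc k"
        using v by blast
      also have "\<dots> \<le> (V - 1) / q ^ Suc k"
        using q le_V[of "n + Suc k"] c_pos[of "Suc k"] by (intro divide_right_mono) auto
      also have "\<dots> \<le> (V - 1) / q ^ 1"
        using q \<open>\<not> V \<le> 1\<close> by (intro divide_left_mono power_increasing) auto
      finally show ?thesis by simp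
    qed
    then have "V \<le> 1 + (V - 1) / q" unfolding V_def by (intro cSup_least) auto
    then have "(V - 1) * (q - 1) \<le> 0" using q by (simp add: field_simps)
    then show False using q \<open>\<not> V \<le> 1\<close> by (simp add: mult_le_0_iff)
  qed
  obtain k where k: "v n - 1 = (v (n + Suc k) - 1 - beta_val q (tail (Suc k) c)) / q ^ Suc k"
    using v by blast
  have "v (n + Suc k) - 1 - beta_val q (tail (Suc k) c) < 0"
    using le_V[of "n + Suc k"] \<open>V \<le> 1\<close> c_pos[of "Suc k"] by simp
  then have "v n - 1 < 0" unfolding k using q by (simp add: divide_less_0_iff)
  then show ?thesis by (simp add: v_def)
qed

lemma tau_infinitely_often: "\<exists>i. tau (n + i)" "\<exists>i. \<not> tau (n + i)"
proof -
  have "tau (2 * n + 1) \<noteq> tau (2 * n + 2)" using tau_odd tau_even by simp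
  moreover have "n + (n + 1) = 2 * n + 1" "n + (n + 2) = 2 * n + 2" by simp_all
  ultimately have "tau (n + (n + 1)) \<noteq> tau (n + (n + 2))" by metis
  then show "\<exists>i. tau (n + i)" "\<exists>i. \<not> tau (n + i)" by blast+
qed

lemma beta_val_powser:
  assumes "1 < q"
  shows "beta_val q c = (1 / q) * (\<Sum>i. of_bool (c i) * (1 / q) ^ i)"
proof -
  have s: "summable (\<lambda>i. of_bool (c i) * (1 / q) ^ i)"
  proof (rule summable_comparison_test)
    show "\<exists>N. \<forall>n\<ge>N. norm (of_bool (c n) * (1 / q) ^ n) \<le> (1 / q) ^ n" using assms by auto
    show "summable (\<lambda>n. (1 / q) ^ n)" using assms by (intro summable_geometric) auto
  qed
  have "(\<lambda>i. of_bool (c i) / q ^ Suc i) = (\<lambda>i. (1 / q) * (of_bool (c i) * (1 / q) ^ i))"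
    by (simp add: power_one_over)
  then show ?thesis unfolding beta_val_def using suminf_mult[OF s, of "1 / q"] by simp
qed

text \<open>The value of \<open>tau\<close> is a power series in \<open>1/q\<close>; it exceeds \<open>1\<close> at \<open>q = 3/2\<close>, already through
  its first two digits, and is below \<open>1\<close> at \<open>q = 2\<close>.\<close>

lemma tau_base_exists: "\<exists>p. 1 < p \<and> p < 2 \<and> beta_val p tau = 1"
proof -
  define f where "f x = x * (\<Sum>i. of_bool (tau i) * x ^ i)" for x :: real
  have f: "beta_val (1 / x) tau = f x" if "0 < x" "x < 1" for x
    using beta_val_powser[of "1 / x" tau] that by (simp add: f_def)
  have "summable (\<lambda>i. of_bool (tau i) * (3 / 4 :: real) ^ i)"
  proof (rule summable_comparison_test)
    show "\<exists>N. \<forall>n\<ge>N. norm (of_bool (tau n) * (3 / 4 :: real) ^ n) \<le> (3 / 4) ^ n" by auto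
    show "summable (\<lambda>n. (3 / 4 :: real) ^ n)" by (intro summable_geometric) auto
  qed
  then have cont: "isCont f x" if "\<bar>x\<bar> < 3 / 4" for x
    unfolding f_def using that by (intro continuous_intros isCont_powser[where K = "3 / 4"]) auto
  have "f (1 / 2) < 1"
  proof -
    have "0 < beta_val 2 (\<lambda>i. \<not> tau i)"
      using tau_values by (intro beta_val_pos[of _ _ 2]) auto
    then show ?thesis using beta_val_not[of 2 tau] f[of "1 / 2"] by simp
  qed
  moreover have "1 < f (2 / 3)"
  proof -
    have "beta_val (3 / 2) tau = (\<Sum>i<2. of_bool (tau i) / (3 / 2) ^ Suc i)
        + beta_val (3 / 2) (tail 2 tau) / (3 / 2) ^ 2"
      by (rule beta_val_split) simp
    moreover have "0 \<le> beta_val (3 / 2) (tail 2 tau)" by (rule beta_val_nonneg) simp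
    ultimately have "1 < beta_val (3 / 2) tau"
      using tau_values by (simp add: eval_nat_numeral)
    then show ?thesis using f[of "2 / 3"] by simp
  qed
  ultimately obtain x where x: "1 / 2 \<le> x" "x \<le> 2 / 3" "f x = 1"
    using IVT[of f "1 / 2" 1 "2 / 3"] cont by auto
  have "x \<noteq> 1 / 2" using x(3) \<open>f (1 / 2) < 1\<close> by (metis less_irrefl)
  then have "1 < 1 / x" "1 / x < 2" using x by (auto simp: field_simps)
  then show ?thesis using f[of x] x by (intro exI[of _ "1 / x"]) auto
qed

definition tau_base :: real where
  "tau_base = (SOME p. 1 < p \<and> p < 2 \<and> beta_val p tau = 1)"

lemma tau_base: "1 < tau_base" "tau_base < 2" "beta_val tau_base tau = 1"
  using someI_ex[OF tau_base_exists] unfolding tau_base_def by auto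

lemma tau_tail_less_1: "beta_val tau_base (tail (Suc n) tau) < 1"
  and tau_complement_tail_less_1: "beta_val tau_base (\<lambda>i. \<not> tau (Suc n + i)) < 1"
proof -
  have "lex_less (tail n (\<lambda>i. tau (Suc i))) tau" "lex_less (tail n (\<lambda>i. \<not> tau (Suc i))) tau" for n
    using tau_maximal[of "Suc n"] by simp_all
  then show "beta_val tau_base (tail (Suc n) tau) < 1"
    "beta_val tau_base (\<lambda>i. \<not> tau (Suc n + i)) < 1"
    using beta_val_less_1_of_lex_less[OF tau_base(1,3) tau_infinitely_often(1), of "\<lambda>i. tau (Suc i)" n]
      beta_val_less_1_of_lex_less[OF tau_base(1,3) tau_infinitely_often(1), of "\<lambda>i. \<not> tau (Suc i)" n]
    by simp_all
qed

lemma tau_val_below_tau_base: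
  assumes "1 < q" "q < tau_base"
  shows "1 < beta_val q tau"
proof -
  let ?f = "\<lambda>i. of_bool (tau i) / q ^ Suc i - of_bool (tau i) / tau_base ^ Suc i"
  have le: "1 / tau_base ^ Suc i < 1 / q ^ Suc i" for i
    using assms tau_base by (intro divide_strict_left_mono power_strict_mono mult_pos_pos zero_less_power) auto
  have "0 < suminf ?f"
  proof (rule suminf_pos2)
    show "summable ?f" by (intro summable_diff beta_summable) (use assms tau_base in auto)
    show "0 \<le> ?f n" for n using le[of n] by auto
    show "0 < ?f 0" using le[of 0] tau_values(1) by auto
  qed
  also have "suminf ?f = beta_val q tau - beta_val tau_base tau"
    unfolding beta_val_def
    by (intro suminf_diff[symmetric] beta_summable) (use assms tau_base in auto)
  finally show ?thesis using tau_base by simp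
qed

text \<open>In a base below \<open>tau_base\<close> some finite prefix of \<open>tau\<close> is worth more than \<open>1\<close>, so a sequence
  of value at most \<open>1\<close> leaves \<open>tau\<close> within that prefix. It cannot leave upwards, because a prefix
  of \<open>tau\<close> with its last digit raised from \<open>0\<close> to \<open>1\<close> is worth more than \<open>1\<close> as well.\<close>

lemma first_diff_tau_of_beta_val:
  assumes q: "1 < q" "q < tau_base"
  obtains M where "\<And>s. beta_val q s \<le> 1 \<Longrightarrow> \<exists>k<M. first_diff k s tau"
proof -
  have "(\<lambda>n. \<Sum>i<n. of_bool (tau i) / q ^ Suc i) \<longlonglongrightarrow> beta_val q tau"
    unfolding beta_val_def using beta_summable[OF q(1)] by (rule summable_LIMSEQ)
  then have "eventually (\<lambda>n. 1 < (\<Sum>i<n. of_bool (tau i) / q ^ Suc i)) sequentially"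
    using tau_val_below_tau_base[OF q] by (rule order_tendstoD)
  then obtain M where M: "1 < (\<Sum>i<M. of_bool (tau i) / q ^ Suc i)"
    using eventually_happens' sequentially_bot by blast
  have "\<exists>k<M. first_diff k s tau" if s: "beta_val q s \<le> 1" for s
  proof -
    have "\<exists>k<M. s k \<noteq> tau k"
    proof (rule ccontr)
      assume "\<not> ?thesis"
      then have "(\<Sum>i<M. of_bool (tau i) / q ^ Suc i) = (\<Sum>i<M. of_bool (s i) / q ^ Suc i :: real)"
        by (intro sum.cong) auto
      also have "\<dots> \<le> beta_val q s"
        using beta_val_split[OF q(1), of s M] beta_val_nonneg[OF q(1), of "tail M s"] q by simp
      finally show False using M s by simp
    qed
    then obtain m where m: "m < M" "s m \<noteq> tau m" by blast
    then have "s \<noteq> tau" by auto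
    then obtain k where k: "first_diff k s tau \<or> first_diff k tau s" by (rule sequences_differ)
    have "k \<le> m"
      using k m(2) unfolding first_diff_def by (metis not_le_imp_less)
    moreover have False if fd: "first_diff k tau s"
    proof -
      have sum: "(\<Sum>i<k. of_bool (s i) / q ^ Suc i) = (\<Sum>i<k. of_bool (tau i) / q ^ Suc i :: real)"
        using fd by (intro sum.cong) (auto simp: first_diff_def)
      have "(\<Sum>i<k. of_bool (tau i) / q ^ Suc i) + 1 / q ^ Suc k \<le> beta_val q s"
        using beta_val_split[OF q(1), of s "Suc k"] beta_val_nonneg[OF q(1), of "tail (Suc k) s"] q fd
        by (simp add: sum first_diff_def)
      moreover have le: "1 / tau_base ^ Suc i \<le> 1 / q ^ Suc i" for i
        using q by (intro divide_left_mono power_mono mult_pos_pos zero_less_power) auto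
      have "(\<Sum>i<k. of_bool (tau i) / tau_base ^ Suc i) \<le> (\<Sum>i<k. of_bool (tau i) / q ^ Suc i :: real)"
        using le by (intro sum_mono) auto
      moreover have "1 = (\<Sum>i<k. of_bool (tau i) / tau_base ^ Suc i)
          + beta_val tau_base (tail (Suc k) tau) / tau_base ^ Suc k"
        using beta_val_split[OF tau_base(1), of tau "Suc k"] tau_base(3) fd
        by (simp add: first_diff_def)
      moreover have "beta_val tau_base (tail (Suc k) tau) / tau_base ^ Suc k < 1 / tau_base ^ Suc k"
        using tau_tail_less_1[of k] tau_base(1) by (intro divide_strict_right_mono) auto
      ultimately show False using s le[of k] by linarith
    qed
    ultimately show ?thesis using k m(1) by (intro exI[of _ k]) auto
  qed
  then show ?thesis using that by blast
qed

lemma admissible_of_beta_val: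
  assumes q: "1 < q" "q < tau_base"
    and c: "\<And>n. beta_val q (tail n c) \<le> 1" "\<And>n. beta_val q (\<lambda>i. \<not> c (n + i)) \<le> 1"
  shows "\<exists>M. admissible M c"
proof -
  obtain M where "\<And>s. beta_val q s \<le> 1 \<Longrightarrow> \<exists>k<M. first_diff k s tau"
    by (rule first_diff_tau_of_beta_val[OF q]) blast
  then have "admissible M c" unfolding admissible_def using c by blast
  then show ?thesis ..
qed

text \<open>No digit can be changed: a \<open>0\<close> could be raised iff the tail after it were worth at least \<open>1\<close>,
  and a \<open>1\<close> could be lowered iff the complementary tail were.\<close>

definition univoque :: "real \<Rightarrow> (nat \<Rightarrow> bool) \<Rightarrow> bool" where
  "univoque q c \<longleftrightarrow> (\<forall>n. (\<not> c n \<longrightarrow> beta_val q (tail (Suc n) c) < 1) \<and>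
     (c n \<longrightarrow> beta_val q (\<lambda>i. \<not> c (Suc n + i)) < 1))"

lemma univoque_not: "univoque q c \<Longrightarrow> univoque q (\<lambda>i. \<not> c i)"
  unfolding univoque_def by simp

lemma univoque_tail_less_1:
  assumes q: "1 < q" "q < 2" and c: "univoque q c" and start: "beta_val q (tail m c) < 1"
  shows "beta_val q (tail (m + n) c) < 1"
proof (induction n)
  case (Suc n)
  show ?case
  proof (cases "c (m + n)")
    case True
    have "q * beta_val q (tail (m + n) c) < q * 1"
      using Suc q by (intro mult_strict_left_mono) auto
    moreover have "beta_val q (tail (m + Suc n) c) = q * beta_val q (tail (m + n) c) - 1"
      using beta_val_tail_Suc[OF q(1), of c "m + n"] True by simp
    ultimately show ?thesis using q by linarith
  next
    case False
    then show ?thesis using c unfolding univoque_def by simp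
  qed
qed (use start in simp)

text \<open>After the first \<open>0\<close> all tails are worth less than \<open>1\<close>, after the first \<open>1\<close> all complementary
  tails are. From then on the sequence is admissible.\<close>

theorem univoque_eventually_periodic:
  assumes q: "1 < q" "q < tau_base" and c: "univoque q c"
  shows "eventually_periodic c"
proof (cases "(\<exists>i. c i) \<and> (\<exists>i. \<not> c i)")
  case False
  then have "c (i + 1) = c i" for i by auto
  then show ?thesis unfolding eventually_periodic_def by (intro exI[of _ 0] exI[of _ 1]) simp
next
  case True
  then obtain m l where m: "\<not> c m" and l: "c l" by blast
  have q2: "q < 2" using q tau_base by simp
  define n where "n = Suc m + Suc l"
  define e where "e = tail n c"
  have "beta_val q (tail (Suc m + k) c) < 1" for k
    using c m unfolding univoque_def by (intro univoque_tail_less_1[OF q(1) q2 c]) blast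
  from this[of "Suc l + _"] have 1: "beta_val q (tail k e) < 1" for k
    unfolding e_def n_def by (simp add: add.assoc)
  have "beta_val q (tail (Suc l + k) (\<lambda>i. \<not> c i)) < 1" for k
    using c l unfolding univoque_def by (intro univoque_tail_less_1[OF q(1) q2 univoque_not[OF c]]) blast
  note 0 = this
  have eq: "Suc l + (Suc m + k) + i = n + (k + i)" for k i by (simp add: n_def)
  have 2: "beta_val q (\<lambda>i. \<not> e (k + i)) < 1" for k
    using 0[of "Suc m + k"] unfolding e_def eq .
  obtain M where "admissible M e"
    using admissible_of_beta_val[OF q, of e] 1 2 by (meson less_imp_le)
  then have "eventually_periodic (tail n c)" unfolding e_def by (rule admissible_eventually_periodic)
  then show ?thesis by (rule eventually_periodic_unshift)
qed

text \<open>Changing a digit changes the tail that is needed after it by \<open>1\<close>. If the new tail value were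
  still in the range of expansions, a second expansion of \<open>x\<close> would arise.\<close>

lemma unique_expansion_univoque:
  assumes q: "1 < q" "q < 2" and unique: "\<And>c. beta_val q c = x \<Longrightarrow> c = e" and e: "beta_val q e = x"
  shows "univoque q e"
proof -
  have flip: False if f: "beta_val q f = beta_val q (tail (Suc n) e) + (if e n then 1 else - 1)" for f n
  proof -
    define c where "c i = (if i < n then e i else if i = n then \<not> e n else f (i - Suc n))" for i
    have tail: "tail (Suc n) c = f" by (auto simp: c_def)
    have "(\<Sum>i<n. of_bool (c i) / q ^ Suc i) = (\<Sum>i<n. of_bool (e i) / q ^ Suc i :: real)"
      by (intro sum.cong) (auto simp: c_def)
    then have "beta_val q c = beta_val q e"
      using beta_val_split[OF q(1), of c "Suc n"] beta_val_split[OF q(1), of e "Suc n"] f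
      unfolding tail by (simp add: c_def add_divide_distrib diff_divide_distrib)
    then have "beta_val q c = x" using e by (rule trans)
    then have "c = e" by (rule unique)
    moreover have "c n \<noteq> e n" by (simp add: c_def)
    ultimately show False by simp
  qed
  show ?thesis unfolding univoque_def
  proof (intro allI conjI impI)
    fix n
    let ?v = "beta_val q (tail (Suc n) e)"
    {
      assume "\<not> e n"
      show "?v < 1"
      proof (rule ccontr)
        assume "\<not> ?v < 1"
        then have "\<exists>f. beta_val q f = ?v - 1"
          using q beta_val_le[OF q(1), of "tail (Suc n) e"] by (intro beta_expansion_exists) auto
        then show False using flip[of _ n] \<open>\<not> e n\<close> by auto
      qed
    next
      assume "e n"
      show "beta_val q (\<lambda>i. \<not> e (Suc n + i)) < 1"
      proof (rule ccontr)
        assume "\<not> ?thesis"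
        then have "?v + 1 \<le> 1 / (q - 1)" using beta_val_not[OF q(1), of "tail (Suc n) e"] by simp
        then have "\<exists>f. beta_val q f = ?v + 1"
          using q beta_val_nonneg[OF q(1), of "tail (Suc n) e"] by (intro beta_expansion_exists) auto
        then show False using flip[of _ n] \<open>e n\<close> by auto
      qed
    }
  qed
qed

text \<open>A unique expansion of \<open>1\<close> would be admissible by its values, and dominating because all its
  proper tails and their complements are worth less than \<open>1\<close>.\<close>

lemma no_unique_expansion_below_tau_base:
  assumes q: "1 < q" "q < tau_base"
  shows "\<not> (\<exists>!c. beta_val q c = 1)"
proof
  assume "\<exists>!c. beta_val q c = 1"
  then obtain e where e: "beta_val q e = 1" "\<And>c. beta_val q c = 1 \<Longrightarrow> c = e" by blast
  have q2: "q < 2" using q tau_base by simp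
  have u: "univoque q e" using unique_expansion_univoque[OF q(1) q2 e(2,1)] .
  have v1: "beta_val q (tail (Suc 0) e) = q - of_bool (e 0)"
    using beta_val_tail_Suc[OF q(1), of e 0] e(1) by simp
  have e0: "e 0"
  proof (rule ccontr)
    assume "\<not> e 0"
    then show False using u v1 q unfolding univoque_def by fastforce
  qed
  have tails: "beta_val q (tail (Suc n) e) < 1" for n
    using univoque_tail_less_1[OF q(1) q2 u, of "Suc 0" n] v1 e0 q2 by simp
  have "beta_val q (tail (Suc 0) (\<lambda>i. \<not> e i)) < 1" using u e0 unfolding univoque_def by blast
  then have ctails: "beta_val q (\<lambda>i. \<not> e (Suc n + i)) < 1" for n
    using univoque_tail_less_1[OF q(1) q2 univoque_not[OF u], of "Suc 0" n] by simp
  have "beta_val q (\<lambda>i. \<not> e i) \<le> 1"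
    using beta_val_Suc[OF q(1), of "\<lambda>i. \<not> e i"] ctails[of 0] e0 q by simp
  then have "beta_val q (tail n e) \<le> 1 \<and> beta_val q (\<lambda>i. \<not> e (n + i)) \<le> 1" for n
    using tails[of "n - 1"] ctails[of "n - 1"] e(1) by (cases n) auto
  then obtain M where "admissible M e" using admissible_of_beta_val[OF q, of e] by blast
  moreover have "dominating e" unfolding dominating_def
  proof (intro allI impI conjI)
    fix n :: nat assume "0 < n"
    then obtain m where m: "n = Suc m" by (cases n) auto
    show "lex_less (\<lambda>i. e (n + i)) e"
      using lex_less_of_beta_val_less[OF q(1) tails, of "tail n e"] tails[of m] e(1) by (simp add: m)
    show "lex_less (\<lambda>i. \<not> e (n + i)) e"
      using lex_less_of_beta_val_less[OF q(1) tails, of "\<lambda>i. \<not> e (n + i)"] ctails[of m] e(1)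
      by (simp add: m)
  qed
  ultimately show False using dominating_not_admissible by blast
qed

text \<open>Changing \<open>tau\<close> at some position would need a tail of \<open>tau\<close>, or of its complement, that is
  worth at least \<open>1\<close>.\<close>

lemma unique_expansion_tau_base:
  assumes "beta_val tau_base c = 1"
  shows "c = tau"
proof (rule ccontr)
  assume "c \<noteq> tau"
  then obtain k where "first_diff k c tau \<or> first_diff k tau c" by (rule sequences_differ)
  then show False
  proof
    assume "first_diff k c tau"
    from first_diff_beta_val[OF tau_base(1) this]
    have "1 + beta_val tau_base (tail (Suc k) tau) = beta_val tau_base (tail (Suc k) c)"
      using assms tau_base by simp
    also have "\<dots> \<le> 1 / (tau_base - 1)" by (rule beta_val_le[OF tau_base(1)])
    finally show False
      using beta_val_not[OF tau_base(1), of "tail (Suc k) tau"] tau_complement_tail_less_1[of k] by simp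
  next
    assume "first_diff k tau c"
    from first_diff_beta_val[OF tau_base(1) this]
    have "1 + beta_val tau_base (tail (Suc k) c) = beta_val tau_base (tail (Suc k) tau)"
      using assms tau_base by simp
    then show False
      using beta_val_nonneg[OF tau_base(1), of "tail (Suc k) c"] tau_tail_less_1[of k] by simp
  qed
qed

lemma base_expansion_iff:
  assumes "1 < q"
  shows "base_expansion q x i \<longleftrightarrow> (\<exists>c. i = (\<lambda>j. of_bool (c j)) \<and> beta_val q c = x)"
proof
  assume i: "base_expansion q x i"
  define c where "c j = (i j = 1)" for j
  have ic: "i = (\<lambda>j. of_bool (c j))"
  proof
    fix j
    have "i j \<in> {0, 1}" using i by (simp add: base_expansion_def)
    then show "i j = of_bool (c j)" by (auto simp: c_def)
  qed
  moreover have "beta_val q c = x"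
    using i sums_unique[of "\<lambda>j. real (i j) / q ^ Suc j" x]
    unfolding base_expansion_def beta_val_def ic by simp
  ultimately show "\<exists>c. i = (\<lambda>j. of_bool (c j)) \<and> beta_val q c = x" by blast
next
  assume "\<exists>c. i = (\<lambda>j. of_bool (c j)) \<and> beta_val q c = x"
  then obtain c where c: "i = (\<lambda>j. of_bool (c j))" "beta_val q c = x" by blast
  have "(\<lambda>j. of_bool (c j) / q ^ Suc j) sums x"
    using summable_sums[OF beta_summable[OF assms, of c]] c(2) by (simp add: beta_val_def)
  then show "base_expansion q x i" unfolding base_expansion_def c(1) by simp
qed

lemma Ex1_image_iff:
  assumes "inj F"
  shows "(\<exists>!i. \<exists>c. i = F c \<and> P c) \<longleftrightarrow> (\<exists>!c. P c)"
  using assms unfolding inj_def by (metis (no_types))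

lemma unique_base_expansion_iff:
  assumes "1 < q"
  shows "(\<exists>!i. base_expansion q x i) \<longleftrightarrow> (\<exists>!c. beta_val q c = x)"
proof -
  have "inj (\<lambda>(c :: nat \<Rightarrow> bool) j. of_bool (c j) :: nat)"
  proof (rule injI, rule ext)
    fix c c' :: "nat \<Rightarrow> bool" and j
    assume "(\<lambda>j. of_bool (c j) :: nat) = (\<lambda>j. of_bool (c' j))"
    then have "of_bool (c j) = (of_bool (c' j) :: nat)" by (rule fun_cong)
    then show "c j = c' j" by (simp only: of_bool_eq_iff)
  qed
  from Ex1_image_iff[OF this, of "\<lambda>c. beta_val q c = x"] show ?thesis
    unfolding base_expansion_iff[OF assms] .
qed

text \<open>The digits \<open>tau\<close> are the only expansion of \<open>1\<close> in base \<open>tau_base\<close>, because they satisfy the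
  lexicographic conditions strictly, so the minimum in the definition of \<open>q_KL\<close> is attained.\<close>

theorem q_KL_eq_tau_base: "q_KL = tau_base"
  unfolding q_KL_def
proof (rule Least_equality)
  show "1 < tau_base \<and> tau_base < 2 \<and> (\<exists>!i. base_expansion tau_base 1 i)"
    using tau_base unique_expansion_tau_base by (auto simp: unique_base_expansion_iff)
  fix q assume "1 < q \<and> q < 2 \<and> (\<exists>!i. base_expansion q 1 i)"
  then show "tau_base \<le> q"
    using no_unique_expansion_below_tau_base[of q] unique_base_expansion_iff[of q 1]
    by (meson not_le)
qed

section \<open>Transcendental bases below the Komornik-Loreti constant\<close>

text \<open>Multiplying the series by \<open>1 - q\<^sup>-\<^sup>p\<close> for the period \<open>p\<close> leaves finitely many terms, hence a
  polynomial relation with integer coefficients. It must be trivial, which says that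
  \<open>b\<close> vanishes on its first \<open>p\<close> places and is periodic from there on.\<close>

lemma transcendental_zero_series:
  fixes b :: "nat \<Rightarrow> int"
  assumes q: "1 < q" "\<not> algebraic q" and b: "eventually_periodic b"
    and sums: "(\<lambda>i. real_of_int (b i) / q ^ i) sums 0"
  shows "b i = 0"
proof -
  obtain m p where p: "0 < p" "\<And>i. m \<le> i \<Longrightarrow> b (i + p) = b i"
    using b unfolding eventually_periodic_def by blast
  \<comment> \<open>\<open>a\<close> collects the coefficients of \<open>(1 - X\<^sup>p) \<Sum> b\<^sub>i X\<^sup>i\<close>\<close>
  define g where "g i = (if p \<le> i then b (i - p) else 0)" for i
  define a where "a i = b i - g i" for i
  define n where "n = m + p"
  have "(\<lambda>i. (1 / q ^ p) * (real_of_int (b i) / q ^ i)) sums ((1 / q ^ p) * 0)"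
    using sums by (rule sums_mult)
  then have "(\<lambda>i. real_of_int (g (i + p)) / q ^ (i + p)) sums 0"
    by (simp add: g_def power_add mult.commute)
  then have "(\<lambda>i. real_of_int (g i) / q ^ i) sums 0"
    by (subst (asm) sums_iff_shift) (simp add: g_def)
  from sums_diff[OF sums this] have "(\<lambda>i. real_of_int (a i) / q ^ i) sums 0"
    by (simp add: a_def diff_divide_distrib)
  moreover have a0: "a i = 0" if "i \<notin> {..<n}" for i
    using p(2)[of "i - p"] that by (simp add: a_def g_def n_def)
  then have "(\<lambda>i. real_of_int (a i) / q ^ i) sums (\<Sum>i<n. real_of_int (a i) / q ^ i)"
    by (intro sums_finite) auto
  ultimately have sum0: "(\<Sum>i<n. real_of_int (a i) / q ^ i) = 0" by (rule sums_unique2[symmetric])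
  define R where "R = (\<Sum>i<n. monom (real_of_int (a i)) (n - i))"
  have coeff: "poly.coeff R j = (\<Sum>i<n. if n - i = j then real_of_int (a i) else 0)" for j
    by (simp add: R_def coeff_sum)
  have "poly R q = (\<Sum>i<n. q ^ n * (real_of_int (a i) / q ^ i))"
    unfolding R_def poly_sum poly_monom using q by (intro sum.cong) (auto simp: power_diff)
  also have "\<dots> = q ^ n * (\<Sum>i<n. real_of_int (a i) / q ^ i)" by (simp only: sum_distrib_left)
  also have "\<dots> = 0" using sum0 by simp
  finally have "poly R q = 0" .
  moreover have "poly.coeff R j \<in> \<int>" for j unfolding coeff by (intro Ints_sum) auto
  ultimately have "R = 0" using q(2) unfolding algebraic_def by blast
  have a: "a i = 0" for i
  proof (cases "i < n")
    case True
    have "poly.coeff R (n - i) = (\<Sum>l<n. if l = i then real_of_int (a l) else 0)"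
      unfolding coeff using True by (intro sum.cong) auto
    also have "\<dots> = real_of_int (a i)" using True by simp
    finally show ?thesis using \<open>R = 0\<close> by simp
  qed (use a0 in simp)
  show ?thesis
  proof (induction i rule: less_induct)
    case (less i)
    show ?case using less[of "i - p"] a[of i] p(1) by (cases "p \<le> i") (auto simp: a_def g_def)
  qed
qed

lemma periodic_multiple:
  fixes e :: "nat \<Rightarrow> 'a"
  assumes "\<forall>i\<ge>m. e (i + p) = e i" "m \<le> i"
  shows "e (i + k * p) = e i"
proof (induction k)
  case (Suc k)
  have "e (i + k * p + p) = e (i + k * p)" using assms by simp
  then show ?case using Suc by (simp add: ac_simps)
qed simp

lemma eventually_periodic_combine:
  assumes "eventually_periodic c" "eventually_periodic d"
  shows "eventually_periodic (\<lambda>i. f (c i) (d i))"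
proof -
  obtain m p where p: "0 < p" "\<forall>i\<ge>m. c (i + p) = c i" using assms(1) unfolding eventually_periodic_def by blast
  obtain l r where r: "0 < r" "\<forall>i\<ge>l. d (i + r) = d i" using assms(2) unfolding eventually_periodic_def by blast
  show ?thesis unfolding eventually_periodic_def
  proof (rule exI[of _ "max m l"], rule exI[of _ "p * r"], intro conjI allI impI)
    show "0 < p * r" using p r by simp
    fix i assume "max m l \<le> i"
    then show "f (c (i + p * r)) (d (i + p * r)) = f (c i) (d i)"
      using periodic_multiple[OF p(2), of i r] periodic_multiple[OF r(2), of i p]
      by (simp add: mult.commute)
  qed
qed

lemma eventually_periodic_case_nat:
  assumes "eventually_periodic c"
  shows "eventually_periodic (case_nat x c)"
  by (rule eventually_periodic_unshift[of _ 1]) (use assms in simp)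

lemma eventually_periodic_Suc:
  assumes "eventually_periodic c"
  shows "eventually_periodic (\<lambda>i. c (Suc i))"
  using assms unfolding eventually_periodic_def by (metis add_Suc le_SucI)

text \<open>Outside the core follow \<open>T\<^sub>0\<close> on the left and \<open>T\<^sub>2\<close> on the right; this computes an expansion
  of \<open>y / (q - 1)\<close>. At an endpoint of \<open>J\<close> the branch is chosen that leads to \<open>0\<close> or \<open>1\<close>, which
  ends in a constant sequence. If no endpoint is met, the expansion is univoque.\<close>

lemma avoiding_core_expansion:
  assumes q: "1 < q" "q < q_KL" and y: "y \<in> {0..1}" "\<not> reaches_core q y"
  shows "\<exists>c. eventually_periodic c \<and> y = (q - 1) * beta_val q c"
proof -
  have q2: "q < 2" using q tau_base by (simp add: q_KL_eq_tau_base)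
  define \<delta> where "\<delta> z \<longleftrightarrow> z = 1 - 1 / q \<or> (1 / q < z)" for z
  define g where "g z = (if \<delta> z then q * z - (q - 1) else q * z)" for z
  define Y where "Y n = (g ^^ n) y" for n
  have half: "1 - 1 / q < 1 / q" using q q2 by (simp add: field_simps)
  have step: "g z \<in> {0..1} \<and> \<not> reaches_core q (g z) \<and>
      (z < 1 - 1 / q \<or> z = 1 - 1 / q \<or> z = 1 / q \<or> 1 / q < z)"
    if z: "z \<in> {0..1}" "\<not> reaches_core q z" for z
  proof -
    have "z \<notin> {1 - 1 / q<..<1 / q}" using z reaches_coreI by blast
    then have cases: "z < 1 - 1 / q \<or> z = 1 - 1 / q \<or> z = 1 / q \<or> 1 / q < z" by force
    have gb: "g z = inv_branch q (if \<delta> z then 2 else 0) z" by (simp add: g_def inv_branch_def)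
    have "g z \<in> {0..1}"
    proof (cases "\<delta> z")
      case True
      then have "1 - 1 / q \<le> z" unfolding \<delta>_def using half by linarith
      then show ?thesis
        unfolding gb using True z(1) q q2 by (subst inv_branch_in_unit_interval_iff) auto
    next
      case False
      then have "z \<le> 1 / q" unfolding \<delta>_def by linarith
      then show ?thesis
        unfolding gb using False z(1) q q2 by (subst inv_branch_in_unit_interval_iff) auto
    qed
    moreover have "\<not> reaches_core q (g z)"
      using reaches_core_inv_branch[of "if \<delta> z then 2 else 0" q z] z(2) unfolding gb by auto
    ultimately show ?thesis using cases by blast
  qed
  have Y: "Y n \<in> {0..1} \<and> \<not> reaches_core q (Y n)" for n
  proof (induction n)
    case (Suc n) then show ?case using step[of "Y n"] by (simp add: Y_def)
  qed (use y in \<open>simp add: Y_def\<close>)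
  have Y_Suc: "Y (Suc n) = g (Y n)" for n by (simp add: Y_def)
  define c where "c n = \<delta> (Y n)" for n
  have val: "beta_val q (tail n c) = Y n / (q - 1)" for n
  proof -
    have "beta_val q (tail n c) = (\<lambda>i. Y (n + i) / (q - 1)) 0"
    proof (rule beta_val_orbitI[OF q(1)])
      show "Y (n + Suc i) / (q - 1) = q * (Y (n + i) / (q - 1)) - of_bool (c (n + i))" for i
        using q by (simp add: Y_Suc g_def c_def diff_divide_distrib)
      show "\<bar>Y (n + i) / (q - 1)\<bar> \<le> 1 / (q - 1)" for i
        using Y[of "n + i"] q by (simp add: divide_right_mono)
    qed
    then show ?thesis by simp
  qed
  have "eventually_periodic c"
  proof (cases "\<exists>n. Y n = 1 - 1 / q \<or> Y n = 1 / q")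
    case True
    then obtain n where n: "Y n = 1 - 1 / q \<or> Y n = 1 / q" by blast
    have fixed: "g 0 = 0" "g 1 = 1" using q by (simp_all add: g_def \<delta>_def)
    have "Y (Suc n) = 0 \<or> Y (Suc n) = 1"
      using n half q by (auto simp: Y_Suc g_def \<delta>_def right_diff_distrib)
    moreover have "Y (Suc n + i) = Y (Suc n)" if "Y (Suc n) = 0 \<or> Y (Suc n) = 1" for i
    proof (induction i)
      case (Suc i)
      have "Y (Suc n + Suc i) = g (Y (Suc n + i))" by (simp add: Y_Suc)
      then show ?case using that fixed Suc by metis
    qed simp
    ultimately have "Y (Suc n + i) = Y (Suc n)" for i by blast
    then have "c (Suc n + (i + 1)) = c (Suc n + i)" for i by (simp only: c_def)
    then have "eventually_periodic (tail (Suc n) c)"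
      unfolding eventually_periodic_def using zero_less_one by blast
    then show ?thesis by (rule eventually_periodic_unshift)
  next
    case False
    have "univoque q c" unfolding univoque_def
    proof (intro allI conjI impI)
      fix n
      have sides: "Y n < 1 - 1 / q \<or> 1 / q < Y n" using step[of "Y n"] Y[of n] False by blast
      {
        assume "\<not> c n"
        then have "Y n < 1 - 1 / q" "Y (Suc n) = q * Y n"
          using sides by (auto simp: c_def \<delta>_def Y_Suc g_def)
        then have "Y (Suc n) < q - 1" using q by (simp add: field_simps)
        then show "beta_val q (tail (Suc n) c) < 1" unfolding val using q by simp
      next
        assume "c n"
        then have "1 / q < Y n" "Y (Suc n) = q * Y n - (q - 1)"
          using False by (auto simp: c_def \<delta>_def Y_Suc g_def)
        then have "1 - Y (Suc n) < q - 1" using q by (simp add: field_simps)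
        then have "(1 - Y (Suc n)) / (q - 1) < 1" using q by simp
        then show "beta_val q (\<lambda>i. \<not> c (Suc n + i)) < 1"
          unfolding beta_val_not[OF q(1)] val by (simp add: diff_divide_distrib)
      }
    qed
    then show ?thesis
      using univoque_eventually_periodic q by (simp add: q_KL_eq_tau_base)
  qed
  moreover have "y = (q - 1) * beta_val q c" using val[of 0] q by (simp add: Y_def)
  ultimately show ?thesis by blast
qed

lemma beta_val_sums:
  assumes "1 < q"
  shows "(\<lambda>i. of_bool (c i) / q ^ Suc i) sums beta_val q c"
  unfolding beta_val_def using beta_summable[OF assms] by (rule summable_sums)

lemma sums_case_nat:
  assumes "1 < q" "(\<lambda>i. real_of_int (b i) / q ^ Suc i) sums s"
  shows "(\<lambda>i. real_of_int (case_nat x b i) / q ^ i) sums (s + real_of_int x)"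
  using sums_Suc[of "\<lambda>i. real_of_int (case_nat x b i) / q ^ i" s] assms by simp

text \<open>The difference of the two expansions has the value \<open>1\<close>, which gives a vanishing series with
  leading coefficient \<open>-1\<close>.\<close>

lemma transcendental_outer_branches_reach:
  assumes q: "1 < q" "q < q_KL" "\<not> algebraic q" and y: "y \<in> {1 - 1 / q<..<1 / q}"
  shows "reaches_core q (q * y) \<or> reaches_core q (q * y - (q - 1))"
proof (rule ccontr)
  assume not: "\<not> ?thesis"
  have "q - 1 < q * y" "q * y < 1" using y q by (auto simp: field_simps)
  then have "q * y \<in> {0..1}" "q * y - (q - 1) \<in> {0..1}"
    unfolding atLeastAtMost_iff using q(1) by linarith+
  then obtain c d where c: "eventually_periodic c" "q * y = (q - 1) * beta_val q c"
    and d: "eventually_periodic d" "q * y - (q - 1) = (q - 1) * beta_val q d"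
    using avoiding_core_expansion[OF q(1,2)] not by meson
  define b where "b i = (of_bool (c i) - of_bool (d i) :: int)" for i
  have "(q - 1) * (beta_val q c - beta_val q d) = (q - 1) * 1"
    using c(2) d(2) by (simp add: right_diff_distrib)
  then have "beta_val q c - beta_val q d = 1" using q by simp
  then have "(\<lambda>i. real_of_int (b i) / q ^ Suc i) sums 1"
    using sums_diff[OF beta_val_sums[OF q(1), of c] beta_val_sums[OF q(1), of d]]
    by (simp add: b_def diff_divide_distrib)
  from sums_case_nat[OF q(1) this, of "- 1"]
  have "(\<lambda>i. real_of_int (case_nat (- 1) b i) / q ^ i) sums 0" by simp
  moreover have "eventually_periodic b"
    using eventually_periodic_combine[OF c(1) d(1), of "\<lambda>u v. of_bool u - of_bool v :: int"]
    by (simp add: b_def[abs_def])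
  ultimately have "case_nat (- 1) b 0 = 0"
    using transcendental_zero_series[OF q(1,3) eventually_periodic_case_nat] by fast
  then show False by simp
qed

text \<open>Up to the factor \<open>q - 1\<close>, let \<open>c\<close> expand \<open>T\<^sub>0 y\<close> and \<open>d\<close> expand \<open>T\<^sub>1 y\<close>. The relation between the two images
  compares the complement of \<open>c\<close> with \<open>2 - q\<close> times \<open>d\<close>. The coefficients of the resulting
  vanishing series force all digits of \<open>d\<close> to be \<open>0\<close>, one after the other. Then \<open>T\<^sub>1 y = 0\<close>, which
  happens only at the endpoint \<open>y = 1/q\<close>.\<close>

lemma transcendental_adjacent_branches_reach:
  assumes q: "1 < q" "q < q_KL" "\<not> algebraic q" and y: "y \<in> {1 - 1 / q<..<1 / q}"
  shows "reaches_core q (q * y) \<or> reaches_core q ((1 - q * y) / (2 - q))"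
proof (rule ccontr)
  assume not: "\<not> ?thesis"
  have q2: "q < 2" using q tau_base by (simp add: q_KL_eq_tau_base)
  have "q * y \<in> {0..1}" "(1 - q * y) / (2 - q) \<in> {0..1}" using y q q2 by (auto simp: field_simps)
  then obtain c d where c: "eventually_periodic c" "q * y = (q - 1) * beta_val q c"
    and d: "eventually_periodic d" "(1 - q * y) / (2 - q) = (q - 1) * beta_val q d"
    using avoiding_core_expansion[OF q(1,2)] not by meson
  define b where "b i = (of_bool (\<not> c i) - 2 * of_bool (d i) + of_bool (d (Suc i)) :: int)" for i
  have val: "beta_val q (\<lambda>i. \<not> c i) = (2 - q) * beta_val q d"
  proof -
    have "(q - 1) * beta_val q (\<lambda>i. \<not> c i) = 1 - q * y"
      using q by (simp add: beta_val_not[OF q(1)] c(2) right_diff_distrib)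
    also have "\<dots> = (2 - q) * ((q - 1) * beta_val q d)" using d(2) q2 by (simp add: field_simps)
    also have "\<dots> = (q - 1) * ((2 - q) * beta_val q d)" by simp
    finally show ?thesis using q by simp
  qed
  have "(\<lambda>i. of_bool (\<not> c i) / q ^ Suc i - 2 * (of_bool (d i) / q ^ Suc i)
      + of_bool (d (Suc i)) / q ^ Suc i) sums
      (beta_val q (\<lambda>i. \<not> c i) - 2 * beta_val q d + beta_val q (\<lambda>i. d (Suc i)))"
    by (intro sums_add sums_diff sums_mult beta_val_sums q)
  moreover have "beta_val q (\<lambda>i. \<not> c i) - 2 * beta_val q d + beta_val q (\<lambda>i. d (Suc i)) = - of_bool (d 0)"
    using beta_val_Suc[OF q(1), of d] q by (simp add: val field_simps)
  ultimately have "(\<lambda>i. real_of_int (b i) / q ^ Suc i) sums (- of_bool (d 0))"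
    by (simp add: b_def diff_divide_distrib add_divide_distrib)
  from sums_case_nat[OF q(1) this, of "of_bool (d 0)"]
  have sums: "(\<lambda>i. real_of_int (case_nat (of_bool (d 0)) b i) / q ^ i) sums 0" by simp
  have "eventually_periodic (\<lambda>i. of_bool (\<not> c i) - 2 * of_bool (d i) :: int)"
    by (rule eventually_periodic_combine[OF c(1) d(1),
          of "\<lambda>u v. of_bool (\<not> u) - 2 * of_bool v :: int"])
  from eventually_periodic_combine[OF this eventually_periodic_Suc[OF d(1)], of "\<lambda>u v. u + of_bool v"]
  have "eventually_periodic b" by (simp add: b_def[abs_def])
  then have zero: "case_nat (of_bool (d 0)) b i = 0" for i
    by (rule transcendental_zero_series[OF q(1,3) eventually_periodic_case_nat sums])
  have "\<not> d i" for i
  proof (induction i)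
    case 0 show ?case using zero[of 0] by simp
  next
    case (Suc i)
    have "b i = 0" using zero[of "Suc i"] by simp
    then show ?case using Suc by (cases "c i"; cases "d (Suc i)") (simp_all add: b_def)
  qed
  then have "beta_val q d = 0" by (simp add: beta_val_def)
  then show False using d(2) y q q2 by (simp add: field_simps)
qed

text \<open>Multiplying \<open>2 - q = (q - 1) \<Sum> c\<^sub>i q\<^sup>-\<^sup>i\<^sup>-\<^sup>1\<close> out and dividing by \<open>q\<close> gives a vanishing series
  with leading coefficient \<open>1\<close>.\<close>

lemma transcendental_endpoint_reaches:
  assumes q: "1 < q" "q < q_KL" "\<not> algebraic q"
  shows "reaches_core q (2 - q)"
proof (rule ccontr)
  assume not: "\<not> ?thesis"
  have q2: "q < 2" using q tau_base by (simp add: q_KL_eq_tau_base)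
  then have "2 - q \<in> {0..1}" using q by simp
  then obtain c where c: "eventually_periodic c" "2 - q = (q - 1) * beta_val q c"
    using avoiding_core_expansion[OF q(1,2) _ not] by blast
  define b where "b i = (of_bool (c (Suc i)) - of_bool (c i) :: int)" for i
  have "(\<lambda>i. of_bool (c (Suc i)) / q ^ Suc i - of_bool (c i) / q ^ Suc i) sums
      (beta_val q (\<lambda>i. c (Suc i)) - beta_val q c)"
    by (intro sums_diff beta_val_sums q)
  moreover have "beta_val q (\<lambda>i. c (Suc i)) - beta_val q c = 2 - q - of_bool (c 0)"
    using beta_val_Suc[OF q(1), of c] q c(2) by (simp add: field_simps)
  ultimately have "(\<lambda>i. real_of_int (b i) / q ^ Suc i) sums (2 - q - of_bool (c 0))"
    by (simp add: b_def diff_divide_distrib)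
  from sums_case_nat[OF q(1) this, of "of_bool (c 0) - 2"]
  have "(\<lambda>i. real_of_int (case_nat (of_bool (c 0) - 2) b i) / q ^ i) sums (- q)" by simp
  from sums_mult[OF this, of "1 / q"]
  have "(\<lambda>i. real_of_int (case_nat (of_bool (c 0) - 2) b i) / q ^ Suc i) sums (- 1)"
    using q by simp
  from sums_case_nat[OF q(1) this, of 1]
  have "(\<lambda>i. real_of_int (case_nat 1 (case_nat (of_bool (c 0) - 2) b) i) / q ^ i) sums 0" by simp
  moreover have "eventually_periodic b"
    using eventually_periodic_combine[OF eventually_periodic_Suc[OF c(1)] c(1),
        of "\<lambda>u v. of_bool u - of_bool v :: int"]
    by (simp add: b_def[abs_def])
  ultimately have "case_nat 1 (case_nat (of_bool (c 0) - 2) b) 0 = 0"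
    using transcendental_zero_series[OF q(1,3)
        eventually_periodic_case_nat[OF eventually_periodic_case_nat]] by fast
  then show False by simp
qed

theorem uniform_dim_bound_transcendental:
  assumes q: "1 < q" "q < q_KL" "\<not> algebraic q"
  shows "\<exists>s::real. s > 0 \<and> (\<forall>y. uncountable (slice q y) \<longrightarrow> ereal s \<le> hausdorff_dim (slice q y))"
proof -
  have "q < 2" using q tau_base by (simp add: q_KL_eq_tau_base)
  then show ?thesis
    by (intro uniform_dim_bound_of_branching two_branches_reach transcendental_endpoint_reaches
        transcendental_outer_branches_reach transcendental_adjacent_branches_reach q) auto
qed

theorem corollary2:
  fixes q :: real
  assumes "q \<in> {1<..<q_aleph0} - {golden_ratio} \<or>
           q \<in> transcendental_reals \<inter> {q_aleph0<..<q_KL}"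
  shows "\<exists>s::real. s > 0 \<and>
    (\<forall>y\<in>{0..1}. uncountable (slice q y) \<longrightarrow> hausdorff_dim (slice q y) \<ge> ereal s)"
proof -
  have "\<exists>s::real. s > 0 \<and> (\<forall>y. uncountable (slice q y) \<longrightarrow> ereal s \<le> hausdorff_dim (slice q y))"
    using assms
  proof
    assume "q \<in> {1<..<q_aleph0} - {golden_ratio}"
    then show ?thesis using q_aleph0_bounds(2) by (intro uniform_dim_bound_small_base) auto
  next
    assume "q \<in> transcendental_reals \<inter> {q_aleph0<..<q_KL}"
    then show ?thesis
      using q_aleph0_bounds(1)
      by (intro uniform_dim_bound_transcendental) (auto simp: transcendental_reals_def)
  qed
  then show ?thesis by blast
qed

end
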